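(* Let $k\ge1$, let $f_k\in\mathbb{V}_k^*=L^2(0,T)$ and let $u_k\in\mathbb{U}_k$ be the solution of $\frac{1}{c^2}u_k''+\lambda_ku_k=f_k$ in $(0,T)$. Then $$\|u_k\|_{\mathbb{U}_k}^2=\sum_{j,\ell=1}^{+\infty}\mathcal{W}_k(\omega_j,\omega_\ell)\,f_{k,j}\,f_{k,\ell},$$ where $(0,+\infty)\times(0,+\infty)\ni(\omega,\widetilde\omega)\mapsto\mathcal{W}_k(\omega,\widetilde\omega)$ is the continuous map given by $$\begin{aligned}\mathcal{W}_k(\omega,\widetilde\omega):={}&\frac{T}{2\lambda_k}\bigl(\operatorname{sinc}((\omega+\widetilde\omega)T)+\operatorname{sinc}((\omega-\widetilde\omega)T)\bigr)\\&+\frac{c^2T}{(\mu_k-\omega^2)(\mu_k-\widetilde\omega^2)}\Bigl[\mu_k\bigl(1+\operatorname{sinc}(2\sqrt{\mu_k}T)\bigr)\\&\quad+\frac{\omega^2+\widetilde\omega^2}{2}\bigl(\operatorname{sinc}((\omega-\widetilde\omega)T)+\operatorname{sinc}((\omega+\widetilde\omega)T)\bigr)\\&\quad-\frac{\mu_k+\omega^2}{2}\bigl(\operatorname{sinc}((\sqrt{\mu_k}-\omega)T)+\operatorname{sinc}((\sqrt{\mu_k}+\omega)T)\bigr)\\&\quad-\frac{\mu_k+\widetilde\omega^2}{2}\bigl(\operatorname{sinc}((\sqrt{\mu_k}-\widetilde\omega)T)+\operatorname{sinc}((\sqrt{\mu_k}+\widetilde\omega)T)\bigr)\Bigr].\end{aligned}$$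 In particular, for the diagonal elements it holds that $$\mathcal{W}_k(\omega_j,\omega_j)=(1+C_{k,\omega_j})\,\|f_{\omega_j}\|_{\mathbb{V}_k^*}^2\qquad\text{for all }j\ge1,$$ where $f_\omega(t):=\cos(\omega t)$.
   Context: $T>0$ is the time horizon and $c>0$ the wave speed. $\Omega\subset\mathbb{R}^d$, $d\ge 1$, is an open, bounded, connected set with Lipschitz boundary, and $0<\lambda_1\le\lambda_2\le\dots\to+\infty$ are the eigenvalues of the Dirichlet Laplacian $-\Delta:H^1_0(\Omega)\to H^{-1}(\Omega)$. Set $\mu_k:=c^2\lambda_k$. $\operatorname{sinc}(x):=\sin(x)/x$ for $x\neq 0$ and $\operatorname{sinc}(0):=1$. $\mathbb{U}_k:=\{w\in H^2(0,T)\mid w(0)=0=w'(0)\}$ is equipped with $\|w\|_{\mathbb{U}_k}^2:=\lambda_k\|w\|_{L^2(0,T)}^2+\frac{1}{c^4\lambda_k}\|w''\|_{L^2(0,T)}^2$, and $\mathbb{V}_k^*:=L^2(0,T)$ with $\|g\|_{\mathbb{V}_k^*}^2:=\frac{1}{\lambda_k}\|g\|_{L^2(0,T)}^2$. Fourier expansion of the source: $f_k(t)=\sum_{j=1}^{+\infty}f_{k,j}\cos(\omega_jt)$, where the coefficients and frequencies are given by $$f_{k,j}:=\int_0^Tf_k(t)\cos(\omega_jt)\,\mathrm{d}t,\qquad \omega_j:=\frac1T\left(\frac\pi2+j\pi\right),\qquad j\ge1.$$ For $\omega>0$ the constant $C_{k,\omega}\in\mathbb{R}$ is defined by $$C_{k,\omega}:=\frac{\mu_k}{1+\operatorname{sinc}(2\sqrt{\mu_k}T)}\left[\frac{T^2}{6}-\frac{T^2}{2}\operatorname{sinc}(2\sqrt{\mu_k}T)-\frac{1}{4\mu_k}\cos(2\sqrt{\mu_k}T)+\frac{1}{4\mu_k}\operatorname{sinc}(2\sqrt{\mu_k}T)\right]$$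 if $\omega=\sqrt{\mu_k}$, and $$C_{k,\omega}:=\frac{2\mu_k}{1+\operatorname{sinc}(2\omega T)}\,\frac{\mu_k+\omega^2}{(\mu_k-\omega^2)^2}\left[1-\operatorname{sinc}((\sqrt{\mu_k}+\omega)T)-\operatorname{sinc}((\sqrt{\mu_k}-\omega)T)+\frac{\mu_k\operatorname{sinc}(2\sqrt{\mu_k}T)+\omega^2\operatorname{sinc}(2\omega T)}{\mu_k+\omega^2}\right]$$ if $\omega\neq\sqrt{\mu_k}$.
   Formalization: Corrected from the printed text, which is false as it stands: the coefficients f_{k,j} carry the factor 2/T, the indices j, ℓ start at 0 instead of 1, and in the resonant C_{k,ω} the last two terms have the opposite signs (+cos/(4μ_k) − sinc/(4μ_k)). *)

theory Defs
  imports "HOL-Analysis.Analysis" "HOL-Probability.Sinc_Integral"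
begin

section \<open>Function spaces\<close>

text \<open>Members of function spaces are honest functions; they are never identified almost everywhere.\<close>

definition L2_space :: "'a::euclidean_space set \<Rightarrow> ('a \<Rightarrow> 'b::euclidean_space) set" where
  "L2_space S = {f. f \<in> borel_measurable (lebesgue_on S) \<and>
                    integrable (lebesgue_on S) (\<lambda>x. (norm (f x))\<^sup>2)}"

definition L2_norm :: "'a::euclidean_space set \<Rightarrow> ('a \<Rightarrow> 'b::euclidean_space) \<Rightarrow> real" where
  "L2_norm S f = sqrt (LINT x|lebesgue_on S. (norm (f x))\<^sup>2)"

text \<open>\<open>\<phi> \<in> C\<^sub>c\<^sup>1(S)\<close> with gradient \<open>G\<close> (for functions on the reals, \<open>G\<close> is the ordinary derivative).
  As in Brezis, \<open>C\<^sub>c\<^sup>1\<close> functions serve as test functions.\<close>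

definition test_function :: "'a::euclidean_space set \<Rightarrow> ('a \<Rightarrow> real) \<Rightarrow> ('a \<Rightarrow> 'a) \<Rightarrow> bool" where
  "test_function S \<phi> G \<longleftrightarrow>
     (\<forall>x. GDERIV \<phi> x :> G x) \<and> continuous_on UNIV G \<and>
     compact (closure {x. \<phi> x \<noteq> 0}) \<and> closure {x. \<phi> x \<noteq> 0} \<subseteq> S"

subsection \<open>Sobolev spaces on the interval \<open>(0, T)\<close>\<close>

definition has_weak_deriv :: "real \<Rightarrow> (real \<Rightarrow> real) \<Rightarrow> (real \<Rightarrow> real) \<Rightarrow> bool" where
  "has_weak_deriv T w v \<longleftrightarrow>
     w \<in> L2_space {0<..<T} \<and> v \<in> L2_space {0<..<T} \<and>
     (\<forall>\<phi> \<phi>'. test_function {0<..<T} \<phi> \<phi>' \<longrightarrow>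
        (LINT t|lebesgue_on {0<..<T}. w t * \<phi>' t) = - (LINT t|lebesgue_on {0<..<T}. v t * \<phi> t))"

text \<open>A representative of the weak derivative, which is unique up to null sets.\<close>

definition weak_deriv :: "real \<Rightarrow> (real \<Rightarrow> real) \<Rightarrow> real \<Rightarrow> real" where
  "weak_deriv T w = (SOME v. has_weak_deriv T w v)"

definition H1 :: "real \<Rightarrow> (real \<Rightarrow> real) set" where
  "H1 T = {w \<in> L2_space {0<..<T}. \<exists>v. has_weak_deriv T w v}"

definition H2 :: "real \<Rightarrow> (real \<Rightarrow> real) set" where
  "H2 T = {w \<in> H1 T. weak_deriv T w \<in> H1 T}"

text \<open>The value at 0 of the continuous representative on \<open>[0, T]\<close>.\<close>

definition has_initial_value :: "real \<Rightarrow> (real \<Rightarrow> real) \<Rightarrow> real \<Rightarrow> bool" where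
  "has_initial_value T w y \<longleftrightarrow>
     (\<exists>v. continuous_on {0..T} v \<and> (AE t in lebesgue_on {0<..<T}. w t = v t) \<and> v 0 = y)"

definition U_space :: "real \<Rightarrow> (real \<Rightarrow> real) set" where
  "U_space T = {w \<in> H2 T. has_initial_value T w 0 \<and> has_initial_value T (weak_deriv T w) 0}"

definition U_norm :: "real \<Rightarrow> real \<Rightarrow> real \<Rightarrow> (real \<Rightarrow> real) \<Rightarrow> real" where
  "U_norm T c lamk w =
     sqrt (lamk * (L2_norm {0<..<T} w)\<^sup>2
           + 1 / (c ^ 4 * lamk) * (L2_norm {0<..<T} (weak_deriv T (weak_deriv T w)))\<^sup>2)"

definition Vstar_norm :: "real \<Rightarrow> real \<Rightarrow> (real \<Rightarrow> real) \<Rightarrow> real" where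
  "Vstar_norm T lamk g = sqrt (1 / lamk * (L2_norm {0<..<T} g)\<^sup>2)"


section \<open>The Dirichlet Laplacian\<close>

text \<open>Near each boundary point, \<open>\<Omega>\<close> is the strict subgraph, in some direction \<open>n\<close>, of a Lipschitz
  function \<open>\<gamma>\<close> on the hyperplane orthogonal to \<open>n\<close>.\<close>

definition lipschitz_boundary :: "'a::euclidean_space set \<Rightarrow> bool" where
  "lipschitz_boundary \<Omega> \<longleftrightarrow>
     (\<forall>p \<in> frontier \<Omega>. \<exists>n N \<gamma> L. norm n = 1 \<and> open N \<and> p \<in> N \<and>
        L-lipschitz_on {y. y \<bullet> n = 0} (\<gamma> :: 'a \<Rightarrow> real) \<and>
        \<Omega> \<inter> N = {x \<in> N. x \<bullet> n < \<gamma> (x - (x \<bullet> n) *\<^sub>R n)})"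

text \<open>\<open>v\<close> lies in \<open>H\<^sub>0\<^sup>1(\<Omega>)\<close>, the \<open>H\<^sup>1\<close>-closure of \<open>C\<^sub>c\<^sup>1(\<Omega>)\<close>, and has weak gradient \<open>g\<close>.\<close>

definition H10_with_gradient ::
    "'a::euclidean_space set \<Rightarrow> ('a \<Rightarrow> real) \<Rightarrow> ('a \<Rightarrow> 'a) \<Rightarrow> bool" where
  "H10_with_gradient \<Omega> v g \<longleftrightarrow>
     v \<in> L2_space \<Omega> \<and> g \<in> L2_space \<Omega> \<and>
     (\<exists>\<phi> G. (\<forall>n. test_function \<Omega> (\<phi> n) (G n)) \<and>
        (\<lambda>n::nat. L2_norm \<Omega> (\<lambda>x. \<phi> n x - v x)) \<longlonglongrightarrow> 0 \<and>
        (\<lambda>n. L2_norm \<Omega> (\<lambda>x. G n x - g x)) \<longlonglongrightarrow> 0)"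

text \<open>\<open>v \<in> H\<^sub>0\<^sup>1(\<Omega>)\<close> and \<open>-\<Delta>v = m v\<close> as functionals in \<open>H\<^sup>-\<^sup>1(\<Omega>)\<close>.\<close>

definition dirichlet_eigen_eq :: "'a::euclidean_space set \<Rightarrow> real \<Rightarrow> ('a \<Rightarrow> real) \<Rightarrow> bool" where
  "dirichlet_eigen_eq \<Omega> m v \<longleftrightarrow>
     (\<exists>g. H10_with_gradient \<Omega> v g \<and>
       (\<forall>w h. H10_with_gradient \<Omega> w h \<longrightarrow>
          (LINT x|lebesgue_on \<Omega>. g x \<bullet> h x) = m * (LINT x|lebesgue_on \<Omega>. v x * w x)))"

text \<open>\<open>lam 1 \<le> lam 2 \<le> \<dots>\<close> lists the eigenvalues with multiplicity: an \<open>L\<^sup>2\<close>-orthonormal system of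
  eigenfunctions for these values exhausts every eigenspace. The value \<open>lam 0\<close> is irrelevant.\<close>

definition dirichlet_eigenvalues :: "'a::euclidean_space set \<Rightarrow> (nat \<Rightarrow> real) \<Rightarrow> bool" where
  "dirichlet_eigenvalues \<Omega> lam \<longleftrightarrow>
     (\<forall>k\<ge>1. 0 < lam k \<and> lam k \<le> lam (Suc k)) \<and> filterlim lam at_top sequentially \<and>
     (\<exists>e :: nat \<Rightarrow> 'a \<Rightarrow> real.
        (\<forall>k\<ge>1. dirichlet_eigen_eq \<Omega> (lam k) (e k)) \<and>
        (\<forall>k\<ge>1. \<forall>l\<ge>1. (LINT x|lebesgue_on \<Omega>. e k x * e l x) = (if k = l then 1 else 0)) \<and>
        (\<forall>m v. dirichlet_eigen_eq \<Omega> m v \<and>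
               (\<forall>k\<ge>1. lam k = m \<longrightarrow> (LINT x|lebesgue_on \<Omega>. v x * e k x) = 0) \<longrightarrow>
               (AE x in lebesgue_on \<Omega>. v x = 0)))"


section \<open>Fourier data, kernel and diagonal constant\<close>

definition freq :: "real \<Rightarrow> nat \<Rightarrow> real" where
  "freq T j = 1 / T * (pi / 2 + real j * pi)"

text \<open>The functions \<open>cos (freq T j t)\<close>, \<open>j \<ge> 0\<close>, form an orthogonal basis of \<open>L\<^sup>2(0, T)\<close>, each of squared
  norm \<open>T / 2\<close>. The normalisation \<open>2 / T\<close>, as well as the index \<open>j = 0\<close>, is therefore needed for
  \<open>f = (\<Sum>j. fourier_coeff T f j * cos (freq T j t))\<close>.\<close>

definition fourier_coeff :: "real \<Rightarrow> (real \<Rightarrow> real) \<Rightarrow> nat \<Rightarrow> real" where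
  "fourier_coeff T f j = 2 / T * (LINT t|lebesgue_on {0<..<T}. f t * cos (freq T j * t))"

definition mu :: "real \<Rightarrow> real \<Rightarrow> real" where
  "mu c lamk = c\<^sup>2 * lamk"

definition W_formula :: "real \<Rightarrow> real \<Rightarrow> real \<Rightarrow> real \<Rightarrow> real \<Rightarrow> real" where
  "W_formula T c lamk \<omega> \<omega>' = (let \<mu> = mu c lamk in
     T / (2 * lamk) * (sinc ((\<omega> + \<omega>') * T) + sinc ((\<omega> - \<omega>') * T))
     + c\<^sup>2 * T / ((\<mu> - \<omega>\<^sup>2) * (\<mu> - \<omega>'\<^sup>2)) *
       (\<mu> * (1 + sinc (2 * sqrt \<mu> * T))
        + (\<omega>\<^sup>2 + \<omega>'\<^sup>2) / 2 * (sinc ((\<omega> - \<omega>') * T) + sinc ((\<omega> + \<omega>') * T))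
        - (\<mu> + \<omega>\<^sup>2) / 2 * (sinc ((sqrt \<mu> - \<omega>) * T) + sinc ((sqrt \<mu> + \<omega>) * T))
        - (\<mu> + \<omega>'\<^sup>2) / 2 * (sinc ((sqrt \<mu> - \<omega>') * T) + sinc ((sqrt \<mu> + \<omega>') * T))))"

text \<open>The formula has removable singularities where \<open>\<omega>\<close> or \<open>\<omega>'\<close> equals \<open>sqrt \<mu>\<close>; there the kernel is the
  limit of the formula along the points where it is meaningful.\<close>

definition W :: "real \<Rightarrow> real \<Rightarrow> real \<Rightarrow> real \<Rightarrow> real \<Rightarrow> real" where
  "W T c lamk \<omega> \<omega>' = (let a = sqrt (mu c lamk) in
     if \<omega> \<noteq> a \<and> \<omega>' \<noteq> a then W_formula T c lamk \<omega> \<omega>'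
     else Lim (at (\<omega>, \<omega>') within (({0<..} - {a}) \<times> ({0<..} - {a})))
              (\<lambda>(x, y). W_formula T c lamk x y))"

text \<open>In the resonant case the last two terms are \<open>+ cos / (4 \<mu>) - sinc / (4 \<mu>)\<close>: this is the limit
  of the non-resonant expression as \<open>\<omega> \<rightarrow> sqrt \<mu>\<close>. The opposite signs, found in the literature, are a
  misprint incompatible with the continuity of the kernel.\<close>

definition C_const :: "real \<Rightarrow> real \<Rightarrow> real \<Rightarrow> real \<Rightarrow> real" where
  "C_const T c lamk \<omega> = (let \<mu> = mu c lamk in
     if \<omega> = sqrt \<mu> then
       \<mu> / (1 + sinc (2 * sqrt \<mu> * T)) *
       (T\<^sup>2 / 6 - T\<^sup>2 / 2 * sinc (2 * sqrt \<mu> * T)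
        + 1 / (4 * \<mu>) * cos (2 * sqrt \<mu> * T) - 1 / (4 * \<mu>) * sinc (2 * sqrt \<mu> * T))
     else
       2 * \<mu> / (1 + sinc (2 * \<omega> * T)) * ((\<mu> + \<omega>\<^sup>2) / (\<mu> - \<omega>\<^sup>2)\<^sup>2) *
       (1 - sinc ((sqrt \<mu> + \<omega>) * T) - sinc ((sqrt \<mu> - \<omega>) * T)
        + (\<mu> * sinc (2 * sqrt \<mu> * T) + \<omega>\<^sup>2 * sinc (2 * \<omega> * T)) / (\<mu> + \<omega>\<^sup>2)))"

end

theory Submission
  imports Defs
begin

text \<open>
  Write \<open>a = sqrt \<mu>\<close>, and let \<open>u\<^sub>\<omega>\<close> be the response to the source \<open>cos (\<omega> t)\<close>. It is
  \<open>c\<^sup>2 t\<^sup>2 / 2 * sinc ((a + \<omega>) t / 2) * sinc ((a - \<omega>) t / 2)\<close>, hence jointly continuous in \<open>\<omega>\<close> and \<open>t\<close>,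
  also across the resonance. The kernel is the inner product of \<open>u\<^sub>\<omega>\<close> and \<open>u\<^sub>\<omega>\<^sub>'\<close> in the space
  \<open>U\<^sub>k\<close>: this is a computation away from the resonance, and it extends to it by continuity.

  The partial Fourier sums of \<open>f\<close> converge to \<open>f\<close> in \<open>L\<^sup>2\<close>, so by an energy estimate the corresponding
  combinations of modes converge uniformly to \<open>u\<close>, and the square partial sums of the double series
  converge to the squared norm of \<open>u\<close>. Since \<open>W(\<omega>\<^sub>j, \<omega>\<^sub>l)\<close> is a multiple of the identity plus
  \<open>O(1 / (\<omega>\<^sub>j \<omega>\<^sub>l))\<close>, Bessel's inequality makes the series absolutely convergent.
\<close>

section \<open>The space L2 on the interval\<close>

text \<open>The obstacle is that \<open>has_sum\<close> over pairs of indices is unordered.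
  Convergence of the square partial sums, which is all that L2 approximation gives, would not
  suffice, so the kernel has to decay in both arguments at once. Reading that decay off the closed
  formula is awkward, because its denominators degenerate near the resonance. It comes instead from
  an energy argument in which the force cos(\<omega> t) enters only through its primitive
  sin(\<omega> t) / \<omega>; integration by parts against the other cosine yields the second
  factor. The same estimate, applied to the difference of u and a sum of modes, tolerates a source
  that is merely in L2. It is phrased with integral equations because the weak derivatives are
  arbitrary representatives and the wave equation holds only almost everywhere.

  Completeness has an obstacle of its own: every cos(\<omega>_j t) vanishes at T, so uniform
  approximation of general continuous functions is impossible and density can only be reached in
  L2.\<close>

lemma integrable_lebesgue_on_continuous:
  fixes g :: "real \<Rightarrow> real"
  assumes "continuous_on {0..T} g"
  shows "integrable (lebesgue_on {0<..<T}) g"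
proof -
  have "g absolutely_integrable_on {0..T}"
    using assms by (rule absolutely_integrable_continuous_real)
  then have "g absolutely_integrable_on {0<..<T}"
    by (rule set_integrable_subset) auto
  then show ?thesis
    by (simp add: integrable_restrict_space set_integrable_def)
qed

lemma LINT_lebesgue_on_continuous:
  fixes g :: "real \<Rightarrow> real"
  assumes "continuous_on {0..T} g"
  shows "(LINT t|lebesgue_on {0<..<T}. g t) = integral {0..T} g"
  using lebesgue_integral_eq_integral[OF integrable_lebesgue_on_continuous[OF assms]]
  by (simp add: integral_open_interval_real)

lemma L2_spaceD:
  assumes "f \<in> L2_space S"
  shows "f \<in> borel_measurable (lebesgue_on S)" "integrable (lebesgue_on S) (\<lambda>x. (norm (f x))\<^sup>2)"
  using assms by (auto simp: L2_space_def)

lemma integrable_power2_L2: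
  fixes f :: "'a::euclidean_space \<Rightarrow> real"
  assumes "f \<in> L2_space S"
  shows "integrable (lebesgue_on S) (\<lambda>x. (f x)\<^sup>2)"
  using L2_spaceD(2)[OF assms] by simp

lemma continuous_in_L2_space:
  fixes g :: "real \<Rightarrow> real"
  assumes "continuous_on {0..T} g"
  shows "g \<in> L2_space {0<..<T}"
  using integrable_lebesgue_on_continuous[OF assms]
    integrable_lebesgue_on_continuous[of T "\<lambda>x. (g x)\<^sup>2"] assms
  by (auto simp: L2_space_def intro!: continuous_intros)

lemma integrable_mult_L2:
  fixes f g :: "'a::euclidean_space \<Rightarrow> real"
  assumes f: "f \<in> L2_space S" and g: "g \<in> L2_space S"
  shows "integrable (lebesgue_on S) (\<lambda>x. f x * g x)"
proof (rule Bochner_Integration.integrable_bound)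
  show "integrable (lebesgue_on S) (\<lambda>x. (f x)\<^sup>2 + (g x)\<^sup>2)"
    using integrable_power2_L2[OF f] integrable_power2_L2[OF g] by simp
  show "(\<lambda>x. f x * g x) \<in> borel_measurable (lebesgue_on S)"
    using L2_spaceD(1)[OF f] L2_spaceD(1)[OF g] by measurable
  have "\<bar>a * b\<bar> \<le> a\<^sup>2 + b\<^sup>2" for a b :: real
  proof -
    have "2 * \<bar>a * b\<bar> \<le> a\<^sup>2 + b\<^sup>2"
      using sum_squares_bound[of "\<bar>a\<bar>" "\<bar>b\<bar>"] by (simp add: abs_mult)
    then show ?thesis using abs_ge_zero[of "a * b"] by linarith
  qed
  then show "AE x in lebesgue_on S. norm (f x * g x) \<le> norm ((f x)\<^sup>2 + (g x)\<^sup>2)"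
    by simp
qed

lemma L2_space_lincomb:
  fixes f g :: "'a::euclidean_space \<Rightarrow> real"
  assumes f: "f \<in> L2_space S" and g: "g \<in> L2_space S"
  shows "(\<lambda>x. a * f x + b * g x) \<in> L2_space S"
proof -
  have "(\<lambda>x. a * f x + b * g x) \<in> borel_measurable (lebesgue_on S)"
    using L2_spaceD(1)[OF f] L2_spaceD(1)[OF g] by measurable
  moreover have "integrable (lebesgue_on S)
      (\<lambda>x. a\<^sup>2 * (f x)\<^sup>2 + 2 * a * b * (f x * g x) + b\<^sup>2 * (g x)\<^sup>2)"
    by (intro Bochner_Integration.integrable_add integrable_mult_right integrable_power2_L2 integrable_mult_L2 f g)
  moreover have "(a * f x + b * g x)\<^sup>2 = a\<^sup>2 * (f x)\<^sup>2 + 2 * a * b * (f x * g x) + b\<^sup>2 * (g x)\<^sup>2" for x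
    by (simp add: power2_eq_square algebra_simps)
  ultimately show ?thesis
    unfolding L2_space_def real_norm_def power2_abs by simp
qed

lemma L2_space_diff:
  fixes f g :: "'a::euclidean_space \<Rightarrow> real"
  assumes "f \<in> L2_space S" "g \<in> L2_space S"
  shows "(\<lambda>x. f x - g x) \<in> L2_space S"
  using L2_space_lincomb[OF assms, of 1 "-1"] by simp

lemma Cauchy_Schwarz_L2:
  fixes f g :: "'a::euclidean_space \<Rightarrow> real"
  assumes f: "f \<in> L2_space S" and g: "g \<in> L2_space S"
  shows "(LINT x|lebesgue_on S. f x * g x)\<^sup>2 \<le>
    (LINT x|lebesgue_on S. (f x)\<^sup>2) * (LINT x|lebesgue_on S. (g x)\<^sup>2)"
proof -
  define A B C where "A = (LINT x|lebesgue_on S. (f x)\<^sup>2)"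
    and "B = (LINT x|lebesgue_on S. f x * g x)" and "C = (LINT x|lebesgue_on S. (g x)\<^sup>2)"
  note ii [simp] = integrable_power2_L2[OF f] integrable_power2_L2[OF g] integrable_mult_L2[OF f g]
  have q: "0 \<le> r\<^sup>2 * A + 2 * r * s * B + s\<^sup>2 * C" for r s
  proof -
    have "0 \<le> (LINT x|lebesgue_on S. (r * f x + s * g x)\<^sup>2)"
      by simp
    also have "\<dots> = (LINT x|lebesgue_on S. r\<^sup>2 * (f x)\<^sup>2 + 2 * r * s * (f x * g x) + s\<^sup>2 * (g x)\<^sup>2)"
      by (rule Bochner_Integration.integral_cong) (auto simp: power2_eq_square algebra_simps)
    finally show ?thesis using ii by (simp add: A_def B_def C_def)
  qed
  have "0 \<le> A" by (simp add: A_def)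
  show ?thesis
    unfolding A_def[symmetric] B_def[symmetric] C_def[symmetric]
  proof (cases "A = 0")
    case False
    then have "A > 0" using \<open>0 \<le> A\<close> by simp
    \<comment> \<open>For s = A the form is minimal at r = -B, where its value is A (A C -
      B^2).\<close>
    have "0 \<le> A * (A * C - B\<^sup>2)"
      using q[of "-B" A] by (simp add: algebra_simps power2_eq_square)
    then show "B\<^sup>2 \<le> A * C" using \<open>A > 0\<close> by (simp add: zero_le_mult_iff)
  next
    case True
    have "B = 0"
    proof (rule ccontr)
      assume "B \<noteq> 0"
      \<comment> \<open>With A = 0 and s = 1 the form is affine in r; at the chosen r it equals
        -1.\<close>
      then show False
        using q[of "- (C + 1) / (2 * B)" 1] True by (simp add: field_simps)
    qed
    then show "B\<^sup>2 \<le> A * C" using True by simp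
  qed
qed

text \<open>Cauchy-Schwarz against the constant 1. It turns the L1 error of the source, which the
  energy estimate produces, into the L2 error that Fourier sums control.\<close>

lemma L1_le_L2:
  assumes f: "f \<in> L2_space {0<..<T}" and "0 < T"
  shows "(LINT t|lebesgue_on {0<..<T}. \<bar>f t :: real\<bar>)\<^sup>2 \<le> T * (LINT t|lebesgue_on {0<..<T}. (f t)\<^sup>2)"
proof -
  have "(\<lambda>t. \<bar>f t\<bar>) \<in> L2_space {0<..<T}"
    using L2_spaceD[OF f] by (auto simp: L2_space_def)
  from Cauchy_Schwarz_L2[OF this continuous_in_L2_space[of T "\<lambda>_. 1"]]
  show ?thesis using \<open>0 < T\<close> by (simp add: LINT_lebesgue_on_continuous mult.commute measure_restrict_space)
qed

text \<open>Expand the square of (g - h) + h; the cross term tends to 0 by Cauchy-Schwarz. This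
  carries L2 convergence of the approximants over to their norms.\<close>

lemma L2_converges_imp_square_converges:
  fixes g :: "nat \<Rightarrow> 'a::euclidean_space \<Rightarrow> real"
  assumes g: "\<And>n. g n \<in> L2_space S" and h: "h \<in> L2_space S"
    and lim: "(\<lambda>n. LINT x|lebesgue_on S. (g n x - h x)\<^sup>2) \<longlonglongrightarrow> 0"
  shows "(\<lambda>n. LINT x|lebesgue_on S. (g n x)\<^sup>2) \<longlonglongrightarrow> (LINT x|lebesgue_on S. (h x)\<^sup>2)"
proof -
  define d where "d n = (\<lambda>x. g n x - h x)" for n
  have d: "d n \<in> L2_space S" for n
    unfolding d_def by (rule L2_space_diff[OF g h])
  have "(\<lambda>n. (LINT x|lebesgue_on S. d n x * h x)\<^sup>2) \<longlonglongrightarrow> 0"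
  proof (rule tendsto_sandwich[OF _ _ tendsto_const])
    show "\<forall>\<^sub>F n in sequentially. (LINT x|lebesgue_on S. d n x * h x)\<^sup>2
        \<le> (LINT x|lebesgue_on S. (d n x)\<^sup>2) * (LINT x|lebesgue_on S. (h x)\<^sup>2)"
      by (intro always_eventually allI Cauchy_Schwarz_L2 d h)
    show "(\<lambda>n. (LINT x|lebesgue_on S. (d n x)\<^sup>2) * (LINT x|lebesgue_on S. (h x)\<^sup>2)) \<longlonglongrightarrow> 0"
      unfolding d_def by (rule tendsto_mult_left_zero[OF lim])
  qed simp
  then have "(\<lambda>n. LINT x|lebesgue_on S. d n x * h x) \<longlonglongrightarrow> 0"
    by (simp add: power_tendsto_0_iff)
  moreover have "(\<lambda>n. LINT x|lebesgue_on S. (d n x)\<^sup>2) \<longlonglongrightarrow> 0"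
    using lim by (simp add: d_def)
  ultimately have "(\<lambda>n. (LINT x|lebesgue_on S. (d n x)\<^sup>2) + (LINT x|lebesgue_on S. d n x * h x) * 2
      + (LINT x|lebesgue_on S. (h x)\<^sup>2)) \<longlonglongrightarrow> 0 + 0 * 2 + (LINT x|lebesgue_on S. (h x)\<^sup>2)"
    by (intro tendsto_intros)
  moreover have "(LINT x|lebesgue_on S. (d n x)\<^sup>2) + (LINT x|lebesgue_on S. d n x * h x) * 2
      + (LINT x|lebesgue_on S. (h x)\<^sup>2) = (LINT x|lebesgue_on S. (g n x)\<^sup>2)" for n
  proof -
    have "(LINT x|lebesgue_on S. (g n x)\<^sup>2)
        = (LINT x|lebesgue_on S. (d n x)\<^sup>2 + (d n x * h x) * 2 + (h x)\<^sup>2)"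
      by (rule Bochner_Integration.integral_cong) (auto simp: d_def power2_eq_square algebra_simps)
    then show ?thesis
      using integrable_power2_L2[OF d[of n]] integrable_power2_L2[OF h] integrable_mult_L2[OF d[of n] h]
      by simp
  qed
  ultimately show ?thesis by (simp only: add_0 mult_zero_left)
qed

section \<open>The forced oscillator\<close>

text \<open>The two integral equations encode D'' + \<mu> D = G' with zero initial data, without
  differentiating G. Only the size of the primitive G enters the bound: for a force cos(\<omega> t)
  this gains a factor 1 / \<omega>, and for an integrable force it costs only its L1 norm.\<close>

lemma oscillator_stability:
  fixes D E G :: "real \<Rightarrow> real"
  assumes "0 < T" "0 \<le> \<mu>"
    and cD: "continuous_on {0..T} D" and cG: "continuous_on {0..T} G"
    and D: "\<And>t. t \<in> {0..T} \<Longrightarrow> D t = integral {0..t} E"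
    and E: "\<And>t. t \<in> {0..T} \<Longrightarrow> E t = G t - \<mu> * integral {0..t} D"
    and G: "\<And>t. t \<in> {0..T} \<Longrightarrow> \<bar>G t\<bar> \<le> \<gamma>"
    and t: "t \<in> {0..T}"
  shows "\<bar>D t\<bar> \<le> 2 * T * \<gamma>"
proof -
  txt \<open>\<open>M'' + \<mu> M = G\<close> holds classically even if \<open>E\<close> is the integral of a merely integrable force;
    the energy of \<open>M\<close> then controls \<open>M' = D\<close>.\<close>
  define M where "M = (\<lambda>t. integral {0..t} D)"
  have M': "(M has_real_derivative D t) (at t within {0..T})" if "t \<in> {0..T}" for t
    unfolding M_def by (rule integral_has_real_derivative[OF cD that])
  have cM: "continuous_on {0..T} M"
    using M' by (meson DERIV_continuous_on)
  have cE: "continuous_on {0..T} E"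
    by (rule continuous_on_eq[of _ "\<lambda>t. G t - \<mu> * M t"])
      (auto simp: E M_def intro!: continuous_intros cG cM[unfolded M_def])
  have D': "(D has_real_derivative E t) (at t within {0..T})" if "t \<in> {0..T}" for t
    by (rule has_field_derivative_transform_within
        [OF integral_has_real_derivative[OF cE that] zero_less_one that]) (simp add: D)
  \<comment> \<open>The energy is evaluated where |D| is maximal: there the maximum m satisfies m^2
    \<le> 2 m \<gamma> T, and one factor m cancels.\<close>
  have "continuous_on {0..T} (\<lambda>t. \<bar>D t\<bar>)" using cD by (intro continuous_intros)
  then obtain t0 where t0: "t0 \<in> {0..T}" and max: "\<And>s. s \<in> {0..T} \<Longrightarrow> \<bar>D s\<bar> \<le> \<bar>D t0\<bar>"
    using continuous_attains_sup[of "{0..T}" "\<lambda>t. \<bar>D t\<bar>"] \<open>0 < T\<close> by auto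
  define m where "m = \<bar>D t0\<bar>"
  have m0: "0 \<le> m" by (simp add: m_def)
  have g0: "0 \<le> \<gamma>" using G[OF t0] by linarith
  \<comment> \<open>Since E + \<mu> M = G, the derivative of this energy is 2 D G.\<close>
  define e where "e = (\<lambda>t. (D t)\<^sup>2 + \<mu> * (M t)\<^sup>2)"
  have "(e has_real_derivative 2 * D t * G t) (at t within {0..T})" if "t \<in> {0..T}" for t
    unfolding e_def
    by (rule derivative_eq_intros D' M' that refl)+
      (simp add: E[OF that] M_def algebra_simps)
  then have "((\<lambda>t. 2 * D t * G t) has_integral (e t0 - e 0)) {0..t0}"
    using t0 by (intro fundamental_theorem_of_calculus)
      (auto simp flip: has_real_derivative_iff_has_vector_derivative
        intro: has_field_derivative_subset[of e _ _ "{0..T}"])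
  then have "e t0 - e 0 \<le> 2 * m * \<gamma> * (t0 - 0)"
  proof (rule has_integral_le)
    show "((\<lambda>_. 2 * m * \<gamma>) has_integral 2 * m * \<gamma> * (t0 - 0)) {0..t0}"
      using t0 has_integral_const_real[of "2 * m * \<gamma>" 0 t0] by (simp add: mult.commute)
    fix t assume "t \<in> {0..t0}"
    then have t: "t \<in> {0..T}" using t0 by auto
    have "D t * G t \<le> \<bar>D t\<bar> * \<bar>G t\<bar>" by (metis abs_ge_self abs_mult)
    also have "\<dots> \<le> m * \<gamma>" using max[OF t] G[OF t] m0 by (intro mult_mono) (auto simp: m_def)
    finally show "2 * D t * G t \<le> 2 * m * \<gamma>" by simp
  qed
  moreover have "e 0 = 0" using D[of 0] \<open>0 < T\<close> by (simp add: e_def M_def)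
  moreover have "m\<^sup>2 \<le> e t0" using \<open>0 \<le> \<mu>\<close> by (simp add: e_def m_def)
  ultimately have "m * m \<le> 2 * m * \<gamma> * t0" by (simp add: power2_eq_square)
  also have "\<dots> \<le> m * (2 * T * \<gamma>)" using mult_left_mono[of t0 T "m * \<gamma>"] m0 g0 t0 by (simp add: mult_ac)
  finally have "m \<le> 2 * T * \<gamma>"
    using m0 g0 \<open>0 < T\<close> by (cases "m = 0") auto
  then show ?thesis using max[OF t] by (simp add: m_def)
qed

text \<open>This form of \<open>c\<^sup>2 (cos (\<omega> t) - cos (a t)) / (a\<^sup>2 - \<omega>\<^sup>2)\<close> is meaningful also for \<open>\<omega> = a\<close>.\<close>

definition wave_mode :: "real \<Rightarrow> real \<Rightarrow> real \<Rightarrow> real \<Rightarrow> real" where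
  "wave_mode c a \<omega> t = c\<^sup>2 * t\<^sup>2 / 2 * sinc ((a + \<omega>) * t / 2) * sinc ((a - \<omega>) * t / 2)"

section \<open>Response to a single cosine source\<close>

lemma wave_mode_nonresonant:
  assumes "0 < a" "0 < \<omega>" "\<omega> \<noteq> a"
  shows "wave_mode c a \<omega> t = c\<^sup>2 / (a\<^sup>2 - \<omega>\<^sup>2) * (cos (\<omega> * t) - cos (a * t))"
proof (cases "t = 0")
  case False
  have *: "sinc ((a + \<omega>) * t / 2) = sin ((a + \<omega>) * t / 2) / ((a + \<omega>) * t / 2)"
    "sinc ((a - \<omega>) * t / 2) = sin ((a - \<omega>) * t / 2) / ((a - \<omega>) * t / 2)"
    using assms False by auto
  have "a\<^sup>2 - \<omega>\<^sup>2 \<noteq> 0" using assms by (simp add: power2_eq_iff)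
  have "cos (\<omega> * t) - cos (a * t) = 2 * sin ((a + \<omega>) * t / 2) * sin ((a - \<omega>) * t / 2)"
    by (simp add: cos_diff_cos algebra_simps)
  moreover have "a\<^sup>2 - \<omega>\<^sup>2 = (a + \<omega>) * (a - \<omega>)" by (simp add: power2_eq_square algebra_simps)
  moreover have "c\<^sup>2 * t\<^sup>2 / 2 * (p / (x * t / 2)) * (q / (y * t / 2)) = c\<^sup>2 / (x * y) * (2 * p * q)"
    if "x \<noteq> 0" "y \<noteq> 0" for x y p q
    using False that by (simp add: field_simps power2_eq_square)
  ultimately show ?thesis
    unfolding wave_mode_def * using assms by simp
qed (simp add: wave_mode_def)

lemma wave_mode_resonant:
  assumes "0 < a"
  shows "wave_mode c a a t = c\<^sup>2 * t * sin (a * t) / (2 * a)"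
  using assms by (simp add: wave_mode_def power2_eq_square)

text \<open>The velocity has different closed forms at and away from the resonance. Obtaining it
  only through its properties confines the case distinction to this proof.\<close>

lemma wave_mode_ode:
  assumes "0 < a" "0 < \<omega>"
  obtains v where
    "\<And>t. (wave_mode c a \<omega> has_real_derivative v t) (at t)"
    "\<And>t. (v has_real_derivative c\<^sup>2 * cos (\<omega> * t) - a\<^sup>2 * wave_mode c a \<omega> t) (at t)"
    "v 0 = 0"
proof (cases "\<omega> = a")
  case True
  show ?thesis
  proof (rule that[of "\<lambda>t. c\<^sup>2 * (sin (a * t) + a * t * cos (a * t)) / (2 * a)"])
    fix t
    show "(wave_mode c a \<omega> has_real_derivative c\<^sup>2 * (sin (a * t) + a * t * cos (a * t)) / (2 * a)) (at t)"
      unfolding True wave_mode_resonant[OF assms(1), abs_def]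
      using assms by (auto intro!: derivative_eq_intros simp: field_simps)
    show "((\<lambda>t. c\<^sup>2 * (sin (a * t) + a * t * cos (a * t)) / (2 * a)) has_real_derivative
        c\<^sup>2 * cos (\<omega> * t) - a\<^sup>2 * wave_mode c a \<omega> t) (at t)"
      unfolding True wave_mode_resonant[OF assms(1), abs_def]
      using assms by (auto intro!: derivative_eq_intros simp: field_simps) (simp add: power2_eq_square algebra_simps)
  qed simp
next
  case False
  have ne: "a\<^sup>2 - \<omega>\<^sup>2 \<noteq> 0" using assms False by (simp add: power2_eq_iff)
  have mode: "wave_mode c a \<omega> = (\<lambda>t. c\<^sup>2 / (a\<^sup>2 - \<omega>\<^sup>2) * (cos (\<omega> * t) - cos (a * t)))"
    using wave_mode_nonresonant[OF assms False] by auto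
  show ?thesis
  proof (rule that[of "\<lambda>t. c\<^sup>2 / (a\<^sup>2 - \<omega>\<^sup>2) * (a * sin (a * t) - \<omega> * sin (\<omega> * t))"])
    fix t
    show "(wave_mode c a \<omega> has_real_derivative
        c\<^sup>2 / (a\<^sup>2 - \<omega>\<^sup>2) * (a * sin (a * t) - \<omega> * sin (\<omega> * t))) (at t)"
      unfolding mode by (rule derivative_eq_intros refl | simp)+
    show "((\<lambda>t. c\<^sup>2 / (a\<^sup>2 - \<omega>\<^sup>2) * (a * sin (a * t) - \<omega> * sin (\<omega> * t))) has_real_derivative
        c\<^sup>2 * cos (\<omega> * t) - a\<^sup>2 * wave_mode c a \<omega> t) (at t)"
      unfolding mode
      by ((rule derivative_eq_intros refl)+)
        (use ne in \<open>simp add: field_simps power2_eq_square\<close>)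
  qed simp
qed

lemma continuous_on_wave_mode [continuous_intros]:
  assumes "continuous_on S f" "continuous_on S g"
  shows "continuous_on S (\<lambda>x. wave_mode c a (f x) (g x))"
  unfolding wave_mode_def by (intro continuous_intros assms) auto

lemma integral_of_derivative:
  fixes F f :: "real \<Rightarrow> real"
  assumes "0 \<le> t" "\<And>x. (F has_real_derivative f x) (at x)"
  shows "integral {0..t} f = F t - F 0"
  using assms
  by (intro integral_unique fundamental_theorem_of_calculus)
    (auto simp flip: has_real_derivative_iff_has_vector_derivative
      intro: has_field_derivative_at_within)

text \<open>This is the form that \<open>oscillator_stability\<close> consumes, with G the primitive
  of c^2 cos(\<omega> t); the division by \<omega> in it is the origin of all later decay.\<close>

lemma wave_mode_integral_equations:
  assumes "0 < a" "0 < \<omega>"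
  obtains v where "continuous_on UNIV v"
    "\<And>t. (wave_mode c a \<omega> has_real_derivative v t) (at t)"
    "\<And>t. 0 \<le> t \<Longrightarrow> wave_mode c a \<omega> t = integral {0..t} v"
    "\<And>t. 0 \<le> t \<Longrightarrow> v t = c\<^sup>2 * (sin (\<omega> * t) / \<omega>) - a\<^sup>2 * integral {0..t} (wave_mode c a \<omega>)"
proof -
  obtain v where v: "\<And>t. (wave_mode c a \<omega> has_real_derivative v t) (at t)"
    "\<And>t. (v has_real_derivative c\<^sup>2 * cos (\<omega> * t) - a\<^sup>2 * wave_mode c a \<omega> t) (at t)" "v 0 = 0"
    using wave_mode_ode[OF assms] by metis
  have w0: "wave_mode c a \<omega> 0 = 0" by (simp add: wave_mode_def)
  have s: "((\<lambda>t. sin (\<omega> * t) / \<omega>) has_real_derivative cos (\<omega> * t)) (at t)" for t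
    using assms by (auto intro!: derivative_eq_intros)
  show ?thesis
  proof (rule that[OF _ v(1)])
    show "continuous_on UNIV v" using v(2) by (meson DERIV_isCont continuous_at_imp_continuous_on)
    fix t :: real assume t: "0 \<le> t"
    show "wave_mode c a \<omega> t = integral {0..t} v"
      using integral_of_derivative[OF t v(1)] w0 by simp
    have "v t = integral {0..t} (\<lambda>t. c\<^sup>2 * cos (\<omega> * t) - a\<^sup>2 * wave_mode c a \<omega> t)"
      using integral_of_derivative[OF t v(2)] v(3) by simp
    also have "\<dots> = integral {0..t} (\<lambda>t. c\<^sup>2 * cos (\<omega> * t)) - integral {0..t} (\<lambda>t. a\<^sup>2 * wave_mode c a \<omega> t)"
      by (rule integral_diff; intro integrable_continuous_real continuous_intros)
    also have "\<dots> = c\<^sup>2 * (sin (\<omega> * t) / \<omega>) - a\<^sup>2 * integral {0..t} (wave_mode c a \<omega>)"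
      using integral_of_derivative[OF t s] by simp
    finally show "v t = c\<^sup>2 * (sin (\<omega> * t) / \<omega>) - a\<^sup>2 * integral {0..t} (wave_mode c a \<omega>)" .
  qed
qed

text \<open>Energy makes the constant uniform across the resonance, where the quotient form of the
  mode would give a bound that blows up.\<close>

lemma wave_mode_bound:
  assumes "0 < T" "0 < a" "0 < \<omega>" "t \<in> {0..T}"
  shows "\<bar>wave_mode c a \<omega> t\<bar> \<le> 2 * T * c\<^sup>2 / \<omega>"
proof -
  obtain v where v: "continuous_on UNIV v"
    "\<And>t. 0 \<le> t \<Longrightarrow> wave_mode c a \<omega> t = integral {0..t} v"
    "\<And>t. 0 \<le> t \<Longrightarrow> v t = c\<^sup>2 * (sin (\<omega> * t) / \<omega>) - a\<^sup>2 * integral {0..t} (wave_mode c a \<omega>)"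
    using wave_mode_integral_equations[OF assms(2,3)] by metis
  have "\<bar>wave_mode c a \<omega> t\<bar> \<le> 2 * T * (c\<^sup>2 * (1 / \<omega>))"
  proof (rule oscillator_stability[where D = "wave_mode c a \<omega>" and E = v and \<mu> = "a\<^sup>2"
      and T = T and G = "\<lambda>t. c\<^sup>2 * (sin (\<omega> * t) / \<omega>)"])
    show "\<bar>c\<^sup>2 * (sin (\<omega> * t) / \<omega>)\<bar> \<le> c\<^sup>2 * (1 / \<omega>)" for t
      using assms by (simp add: abs_mult divide_right_mono mult_left_le)
  qed (use assms v in \<open>auto intro!: continuous_intros\<close>)
  then show ?thesis by simp
qed

text \<open>Integrating cos(\<omega> t) by parts gives 1 / \<omega>, and both the mode and its
  velocity are of order 1 / \<omega>'. In the constant, the boundary term contributes 2 T c^2, while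
  the velocity integrated over [0, T] contributes T c^2 + 2 T^3 a^2 c^2.\<close>

lemma cos_wave_mode_bound:
  assumes "0 < T" "0 < a" "0 < \<omega>" "0 < \<omega>'"
  shows "\<bar>integral {0..T} (\<lambda>t. cos (\<omega> * t) * wave_mode c a \<omega>' t)\<bar>
    \<le> (3 * T * c\<^sup>2 + 2 * T^3 * a\<^sup>2 * c\<^sup>2) / (\<omega> * \<omega>')"
proof -
  define w where "w = wave_mode c a \<omega>'"
  obtain v where v: "continuous_on UNIV v"
    "\<And>t. (w has_real_derivative v t) (at t)"
    "\<And>t. 0 \<le> t \<Longrightarrow> v t = c\<^sup>2 * (sin (\<omega>' * t) / \<omega>') - a\<^sup>2 * integral {0..t} w"
    using wave_mode_integral_equations[OF assms(2,4)] unfolding w_def by metis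
  have cw: "continuous_on S w" for S unfolding w_def by (intro continuous_intros)
  have cv: "continuous_on S v" for S using v(1) by (rule continuous_on_subset) simp
  have wb: "\<bar>w t\<bar> \<le> 2 * T * c\<^sup>2 / \<omega>'" if "t \<in> {0..T}" for t
    unfolding w_def by (rule wave_mode_bound) (use assms that in auto)
  \<comment> \<open>The velocity is estimated through its own integral equation, so it inherits the
    factor 1 / \<omega>' from the mode.\<close>
  have vb: "\<bar>v t\<bar> \<le> (c\<^sup>2 + 2 * T\<^sup>2 * a\<^sup>2 * c\<^sup>2) / \<omega>'" if t: "t \<in> {0..T}" for t
  proof -
    have "\<bar>integral {0..t} w\<bar> \<le> 2 * T * c\<^sup>2 / \<omega>' * (t - 0)"
      using integral_bound[of 0 t w "2 * T * c\<^sup>2 / \<omega>'"] wb t cw by auto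
    also have "\<dots> \<le> 2 * T * c\<^sup>2 / \<omega>' * T"
      using t assms by (intro mult_left_mono) auto
    finally have "a\<^sup>2 * \<bar>integral {0..t} w\<bar> \<le> a\<^sup>2 * (2 * T * c\<^sup>2 / \<omega>' * T)"
      by (rule mult_left_mono) simp
    moreover have "\<bar>c\<^sup>2 * (sin (\<omega>' * t) / \<omega>')\<bar> \<le> c\<^sup>2 * (1 / \<omega>')"
      using assms by (simp add: abs_mult divide_right_mono mult_left_le)
    ultimately have "\<bar>v t\<bar> \<le> c\<^sup>2 * (1 / \<omega>') + a\<^sup>2 * (2 * T * c\<^sup>2 / \<omega>' * T)"
      using v(3)[of t] t by (auto simp: abs_mult intro!: order_trans[OF abs_triangle_ineq4])
    then show ?thesis by (simp add: add_divide_distrib power2_eq_square mult_ac)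
  qed
  have "((\<lambda>t. sin (\<omega> * t) / \<omega> * w t) has_real_derivative
      cos (\<omega> * t) * w t + sin (\<omega> * t) / \<omega> * v t) (at t)" for t
    using assms by (auto intro!: derivative_eq_intros v(2) simp: field_simps)
  from integral_of_derivative[OF _ this, of T]
  have "integral {0..T} (\<lambda>t. cos (\<omega> * t) * w t + sin (\<omega> * t) / \<omega> * v t) = sin (\<omega> * T) / \<omega> * w T"
    using assms by simp
  moreover have "integral {0..T} (\<lambda>t. cos (\<omega> * t) * w t + sin (\<omega> * t) / \<omega> * v t)
      = integral {0..T} (\<lambda>t. cos (\<omega> * t) * w t) + integral {0..T} (\<lambda>t. sin (\<omega> * t) / \<omega> * v t)"
    using assms by (intro integral_add integrable_continuous_real continuous_intros cw cv) auto
  ultimately have eq: "integral {0..T} (\<lambda>t. cos (\<omega> * t) * w t)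
      = sin (\<omega> * T) / \<omega> * w T - integral {0..T} (\<lambda>t. sin (\<omega> * t) / \<omega> * v t)" by simp
  have s: "\<bar>sin (\<omega> * t) / \<omega>\<bar> \<le> 1 / \<omega>" for t
    using assms by (simp add: divide_right_mono)
  have "\<bar>sin (\<omega> * T) / \<omega> * w T\<bar> \<le> 1 / \<omega> * (2 * T * c\<^sup>2 / \<omega>')"
    unfolding abs_mult using s wb assms by (intro mult_mono) auto
  moreover have "\<bar>integral {0..T} (\<lambda>t. sin (\<omega> * t) / \<omega> * v t)\<bar>
      \<le> 1 / \<omega> * ((c\<^sup>2 + 2 * T\<^sup>2 * a\<^sup>2 * c\<^sup>2) / \<omega>') * (T - 0)"
  proof -
    have "norm (sin (\<omega> * t) / \<omega> * v t) \<le> 1 / \<omega> * ((c\<^sup>2 + 2 * T\<^sup>2 * a\<^sup>2 * c\<^sup>2) / \<omega>')"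
      if "t \<in> {0..T}" for t
      unfolding real_norm_def abs_mult using s vb[OF that] assms by (intro mult_mono) auto
    then show ?thesis
      using integral_bound[of 0 T "\<lambda>t. sin (\<omega> * t) / \<omega> * v t"] assms
      by (force intro!: continuous_intros cv)
  qed
  ultimately have "\<bar>integral {0..T} (\<lambda>t. cos (\<omega> * t) * w t)\<bar>
      \<le> 1 / \<omega> * (2 * T * c\<^sup>2 / \<omega>') + 1 / \<omega> * ((c\<^sup>2 + 2 * T\<^sup>2 * a\<^sup>2 * c\<^sup>2) / \<omega>') * (T - 0)"
    unfolding eq by (intro order_trans[OF abs_triangle_ineq4]) auto
  also have "\<dots> = (3 * T * c\<^sup>2 + 2 * T^3 * a\<^sup>2 * c\<^sup>2) / (\<omega> * \<omega>')"
    using assms by (simp add: field_simps power2_eq_square power3_eq_cube)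
  finally show ?thesis by (simp add: w_def)
qed

section \<open>The kernel\<close>

lemma freq_pos: "0 < T \<Longrightarrow> 0 < freq T j"
  by (simp add: freq_def add_pos_nonneg)

lemma integral_cos:
  assumes "0 \<le> T"
  shows "integral {0..T} (\<lambda>t. cos (x * t)) = T * sinc (x * T)"
proof (cases "x = 0")
  case False
  then have "((\<lambda>t. sin (x * t) / x) has_real_derivative cos (x * t)) (at t)" for t
    by (auto intro!: derivative_eq_intros)
  from integral_of_derivative[OF assms this] False show ?thesis by simp
qed (use assms in simp)

lemma integral_cos_cos:
  assumes "0 \<le> T"
  shows "integral {0..T} (\<lambda>t. cos (x * t) * cos (y * t)) = T / 2 * (sinc ((x + y) * T) + sinc ((x - y) * T))"
proof -
  have "integral {0..T} (\<lambda>t. cos (x * t) * cos (y * t))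
      = integral {0..T} (\<lambda>t. 1 / 2 * (cos ((x + y) * t) + cos ((x - y) * t)))"
    by (simp add: cos_times_cos distrib_right left_diff_distrib add.commute)
  also have "\<dots> = 1 / 2 * (integral {0..T} (\<lambda>t. cos ((x + y) * t)) + integral {0..T} (\<lambda>t. cos ((x - y) * t)))"
    by (subst integral_add[symmetric]) (auto intro!: integrable_continuous_real continuous_intros)
  also have "\<dots> = 1 / 2 * (T * sinc ((x + y) * T) + T * sinc ((x - y) * T))"
    by (simp only: integral_cos[OF assms])
  finally show ?thesis by (simp only: distrib_left[symmetric])
qed

text \<open>Substituting u'' = c^2 (cos(\<omega> t) - lamk u) cancels the c^4 in the weight of the
  second derivatives, which leaves the weight 1 / lamk.\<close>

definition mode_integrand :: "real \<Rightarrow> real \<Rightarrow> real \<Rightarrow> real \<Rightarrow> real \<Rightarrow> real \<Rightarrow> real" where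
  "mode_integrand c lamk a \<omega> \<omega>' t =
     lamk * (wave_mode c a \<omega> t * wave_mode c a \<omega>' t) +
     1 / lamk * ((cos (\<omega> * t) - lamk * wave_mode c a \<omega> t) * (cos (\<omega>' * t) - lamk * wave_mode c a \<omega>' t))"

text \<open>The inner product of \<open>u\<^sub>\<omega>\<close> and \<open>u\<^sub>\<omega>\<^sub>'\<close> in \<open>U\<^sub>k\<close>, where \<open>u''\<close> is eliminated by the
  differential equation.\<close>

definition mode_inner :: "real \<Rightarrow> real \<Rightarrow> real \<Rightarrow> real \<Rightarrow> real \<Rightarrow> real" where
  "mode_inner T c lamk \<omega> \<omega>' = integral {0..T} (mode_integrand c lamk (sqrt (mu c lamk)) \<omega> \<omega>')"

lemma continuous_on_mode_integrand:
  "continuous_on S (mode_integrand c lamk a \<omega> \<omega>')"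
  unfolding mode_integrand_def by (intro continuous_intros)

text \<open>No frequency has to be excluded, because \<open>wave_mode\<close> is built from sinc.
  This is what will give the kernel its values on the resonant lines.\<close>

lemma continuous_on_mode_inner:
  "continuous_on S (\<lambda>(x, y). mode_inner T c lamk x y)"
proof -
  have "continuous_on (UNIV \<times> cbox 0 T)
      (\<lambda>(z, t). mode_integrand c lamk (sqrt (mu c lamk)) (fst z) (snd z) t)"
    unfolding mode_integrand_def case_prod_beta by (intro continuous_intros)
  from integral_continuous_on_param[OF this]
  have "continuous_on UNIV (\<lambda>(x, y). mode_inner T c lamk x y)"
    by (simp add: mode_inner_def case_prod_beta)
  then show ?thesis by (rule continuous_on_subset) simp
qed

section \<open>The kernel as an inner product of modes\<close>

context
  fixes T c lamk a :: real
  assumes T: "0 < T" and c: "0 < c" and lamk: "0 < lamk"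
  defines "a \<equiv> sqrt (mu c lamk)"
begin

lemma sqrt_mu_pos: "0 < a" and sqrt_mu_power2: "a\<^sup>2 = c\<^sup>2 * lamk"
  using c lamk by (auto simp: a_def mu_def)

text \<open>Over the common denominator lamk d d' the integrand is a combination of products of two
  cosines, and each of these integrates to a pair of sinc values.\<close>

lemma W_formula_eq_mode_inner:
  assumes "0 < \<omega>" "0 < \<omega>'" "\<omega> \<noteq> a" "\<omega>' \<noteq> a"
  shows "W_formula T c lamk \<omega> \<omega>' = mode_inner T c lamk \<omega> \<omega>'"
proof -
  define \<mu> where "\<mu> = mu c lamk"
  have \<mu>: "\<mu> = a\<^sup>2" "\<mu> = c\<^sup>2 * lamk" using sqrt_mu_power2 by (auto simp: \<mu>_def mu_def)
  define d d' where "d = \<mu> - \<omega>\<^sup>2" and "d' = \<mu> - \<omega>'\<^sup>2"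
  have nz: "d \<noteq> 0" "d' \<noteq> 0"
    using assms sqrt_mu_pos by (auto simp: d_def d'_def \<mu>(1) power2_eq_iff)
  \<comment> \<open>Since lamk c^2 = \<mu>, this is the second derivative of the mode divided by
    c^2.\<close>
  have shape: "cos (x * t) - lamk * (c\<^sup>2 / (\<mu> - x\<^sup>2) * (cos (x * t) - cos (a * t)))
      = (\<mu> * cos (a * t) - x\<^sup>2 * cos (x * t)) / (\<mu> - x\<^sup>2)" if "\<mu> - x\<^sup>2 \<noteq> 0" for x t
    using that by (simp add: field_simps \<mu>(2))
  \<comment> \<open>A, C, C' stand for the cosines with frequencies a, \<omega>, \<omega>'; the
    identity rests on lamk^2 c^4 = \<mu>^2.\<close>
  have alg: "lamk * (c\<^sup>2 / d * (C - A) * (c\<^sup>2 / d' * (C' - A)))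
        + 1 / lamk * ((\<mu> * A - \<omega>\<^sup>2 * C) / d * ((\<mu> * A - \<omega>'\<^sup>2 * C') / d'))
      = 1 / (lamk * (d * d')) * ((\<mu>\<^sup>2 + \<omega>\<^sup>2 * \<omega>'\<^sup>2) * (C * C') - \<mu> * (\<mu> + \<omega>\<^sup>2) * (A * C)
          - \<mu> * (\<mu> + \<omega>'\<^sup>2) * (A * C') + 2 * \<mu>\<^sup>2 * (A * A))" for A C C'
  proof -
    have "lamk * (c\<^sup>2 / d * (C - A) * (c\<^sup>2 / d' * (C' - A)))
        = 1 / (lamk * (d * d')) * (\<mu>\<^sup>2 * (C - A) * (C' - A))"
      using nz lamk by (simp add: \<mu>(2) field_simps power2_eq_square)
    moreover have "1 / lamk * ((\<mu> * A - \<omega>\<^sup>2 * C) / d * ((\<mu> * A - \<omega>'\<^sup>2 * C') / d'))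
        = 1 / (lamk * (d * d')) * ((\<mu> * A - \<omega>\<^sup>2 * C) * (\<mu> * A - \<omega>'\<^sup>2 * C'))"
      using nz lamk by simp
    ultimately show ?thesis
      by (simp only: distrib_left[symmetric]) (simp add: algebra_simps power2_eq_square)
  qed
  define K where "K x y = integral {0..T} (\<lambda>t. cos (x * t) * cos (y * t))" for x y
  have K: "((\<lambda>t. cos (x * t) * cos (y * t)) has_integral K x y) {0..T}" for x y
    unfolding K_def by (intro integrable_integral integrable_continuous_real continuous_intros)
  have "mode_integrand c lamk a \<omega> \<omega>' t = 1 / (lamk * (d * d')) *
      ((\<mu>\<^sup>2 + \<omega>\<^sup>2 * \<omega>'\<^sup>2) * (cos (\<omega> * t) * cos (\<omega>' * t)) - \<mu> * (\<mu> + \<omega>\<^sup>2) * (cos (a * t) * cos (\<omega> * t))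
          - \<mu> * (\<mu> + \<omega>'\<^sup>2) * (cos (a * t) * cos (\<omega>' * t)) + 2 * \<mu>\<^sup>2 * (cos (a * t) * cos (a * t)))" for t
    unfolding mode_integrand_def wave_mode_nonresonant[OF sqrt_mu_pos assms(1,3)]
      wave_mode_nonresonant[OF sqrt_mu_pos assms(2,4)] \<mu>(1)[symmetric]
      shape[OF nz(1)[unfolded d_def]] shape[OF nz(2)[unfolded d'_def]]
    using alg[of "cos (\<omega> * t)" "cos (a * t)" "cos (\<omega>' * t)"] by (simp only: d_def d'_def)
  moreover have "((\<lambda>t. 1 / (lamk * (d * d')) *
      ((\<mu>\<^sup>2 + \<omega>\<^sup>2 * \<omega>'\<^sup>2) * (cos (\<omega> * t) * cos (\<omega>' * t)) - \<mu> * (\<mu> + \<omega>\<^sup>2) * (cos (a * t) * cos (\<omega> * t))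
          - \<mu> * (\<mu> + \<omega>'\<^sup>2) * (cos (a * t) * cos (\<omega>' * t)) + 2 * \<mu>\<^sup>2 * (cos (a * t) * cos (a * t))))
      has_integral 1 / (lamk * (d * d')) * ((\<mu>\<^sup>2 + \<omega>\<^sup>2 * \<omega>'\<^sup>2) * K \<omega> \<omega>' - \<mu> * (\<mu> + \<omega>\<^sup>2) * K a \<omega>
          - \<mu> * (\<mu> + \<omega>'\<^sup>2) * K a \<omega>' + 2 * \<mu>\<^sup>2 * K a a)) {0..T}"
    by (intro has_integral_mult_right has_integral_add has_integral_diff K)
  ultimately have inner: "mode_inner T c lamk \<omega> \<omega>' = 1 / (lamk * (d * d')) * ((\<mu>\<^sup>2 + \<omega>\<^sup>2 * \<omega>'\<^sup>2) * K \<omega> \<omega>'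
      - \<mu> * (\<mu> + \<omega>\<^sup>2) * K a \<omega> - \<mu> * (\<mu> + \<omega>'\<^sup>2) * K a \<omega>' + 2 * \<mu>\<^sup>2 * K a a)"
    unfolding mode_inner_def a_def[symmetric]
    by - (rule integral_unique, erule has_integral_eq[rotated], simp only:)
  \<comment> \<open>An opaque name for sinc, so that its case distinction at 0 stays out of the
    algebra.\<close>
  define S where "S = (\<lambda>x::real. sinc x)"
  have KS: "K x y = T / 2 * (S ((x + y) * T) + S ((x - y) * T))" for x y
    unfolding K_def S_def using T by (intro integral_cos_cos) simp
  have S0: "S ((a + a) * T) + S ((a - a) * T) = 1 + S (2 * a * T)"
    by (simp add: S_def)
  have "W_formula T c lamk \<omega> \<omega>' = T / (2 * lamk) * (S ((\<omega> + \<omega>') * T) + S ((\<omega> - \<omega>') * T))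
     + c\<^sup>2 * T / (d * d') * (\<mu> * (1 + S (2 * a * T))
        + (\<omega>\<^sup>2 + \<omega>'\<^sup>2) / 2 * (S ((\<omega> - \<omega>') * T) + S ((\<omega> + \<omega>') * T))
        - (\<mu> + \<omega>\<^sup>2) / 2 * (S ((a - \<omega>) * T) + S ((a + \<omega>) * T))
        - (\<mu> + \<omega>'\<^sup>2) / 2 * (S ((a - \<omega>') * T) + S ((a + \<omega>') * T)))"
    by (simp only: W_formula_def Let_def S_def d_def d'_def \<mu>_def a_def)
  moreover have "1 / (lamk * (d * d')) * ((\<mu>\<^sup>2 + \<omega>\<^sup>2 * \<omega>'\<^sup>2) * (T / 2 * (s1 + s1'))
      - \<mu> * (\<mu> + \<omega>\<^sup>2) * (T / 2 * (s2 + s2')) - \<mu> * (\<mu> + \<omega>'\<^sup>2) * (T / 2 * (s3 + s3'))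
      + 2 * \<mu>\<^sup>2 * (T / 2 * (1 + s4)))
    = T / (2 * lamk) * (s1 + s1')
     + c\<^sup>2 * T / (d * d') * (\<mu> * (1 + s4) + (\<omega>\<^sup>2 + \<omega>'\<^sup>2) / 2 * (s1' + s1)
        - (\<mu> + \<omega>\<^sup>2) / 2 * (s2' + s2) - (\<mu> + \<omega>'\<^sup>2) / 2 * (s3' + s3))" for s1 s1' s2 s2' s3 s3' s4
  \<comment> \<open>The two summands of \<open>W_formula\<close> arise by splitting the coefficient
    \<mu>^2 + \<omega>^2 \<omega>'^2 as d d' + \<mu> (\<omega>^2 + \<omega>'^2); in the first part d
    d' cancels.\<close>
  proof -
    have "c\<^sup>2 * T / (d * d') = 1 / (lamk * (d * d')) * (\<mu> * T)"
      using nz lamk by (simp add: \<mu>(2) field_simps)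
    moreover have "T / (2 * lamk) = 1 / (lamk * (d * d')) * ((\<mu> - \<omega>\<^sup>2) * (\<mu> - \<omega>'\<^sup>2) * T / 2)"
      using nz lamk unfolding d_def[symmetric] d'_def[symmetric] by simp
    ultimately show ?thesis
      by (simp only: mult.assoc distrib_left[symmetric])
        (simp add: algebra_simps power2_eq_square add_divide_distrib diff_divide_distrib)
  qed
  ultimately show ?thesis
    unfolding inner KS S0 by simp
qed

text \<open>\<open>Lim\<close> has a determined value only along a nontrivial filter. Nearby points
  are found on the diagonal through (x, y), where only two shifts meet the excluded lines.\<close>

lemma punctured_quadrant_limit_point:
  fixes b x y :: real
  assumes "0 < x" "0 < y"
  shows "(x, y) islimpt ({0<..} - {b}) \<times> ({0<..} - {b})"
  unfolding islimpt_approachable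
proof (intro allI impI)
  fix e :: real assume "0 < e"
  then have "infinite ({0<..<e / 2} - {b - x, b - y})" by simp
  then obtain r where "r \<in> {0<..<e / 2} - {b - x, b - y}"
    by (metis all_not_in_conv finite.emptyI)
  then have r: "0 < r" "r < e / 2" "r \<noteq> b - x" "r \<noteq> b - y" by auto
  have "dist (x + r, y + r) (x, y) \<le> dist (x + r) x + dist (y + r) y"
    unfolding dist_Pair_Pair by (rule sqrt_sum_squares_le_sum) auto
  also have "\<dots> < e" using r by (simp add: dist_real_def)
  finally show "\<exists>z\<in>({0<..} - {b}) \<times> ({0<..} - {b}). z \<noteq> (x, y) \<and> dist z (x, y) < e"
    using assms r by (intro bexI[of _ "(x + r, y + r)"]) auto
qed

text \<open>On the punctured quadrant the formula agrees with a function that is continuous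
  everywhere, so the limit that defines \<open>W\<close> at resonant arguments is the value of that
  function.\<close>

lemma W_eq_mode_inner:
  assumes "0 < \<omega>" "0 < \<omega>'"
  shows "W T c lamk \<omega> \<omega>' = mode_inner T c lamk \<omega> \<omega>'"
proof (cases "\<omega> \<noteq> a \<and> \<omega>' \<noteq> a")
  case True
  then show ?thesis
    using W_formula_eq_mode_inner[OF assms] by (simp add: W_def a_def[symmetric] Let_def)
next
  case False
  define D where "D = ({0<..} - {a}) \<times> ({0<..} - {a})"
  have "((\<lambda>(x, y). mode_inner T c lamk x y) \<longlongrightarrow> mode_inner T c lamk \<omega> \<omega>') (at (\<omega>, \<omega>') within D)"
    using continuous_on_mode_inner[of UNIV T c lamk]
    by (auto simp: continuous_on_def intro: tendsto_within_subset)
  moreover have "\<forall>\<^sub>F z in at (\<omega>, \<omega>') within D.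
      (case z of (x, y) \<Rightarrow> mode_inner T c lamk x y) = (case z of (x, y) \<Rightarrow> W_formula T c lamk x y)"
    unfolding eventually_at_filter
    by (intro always_eventually allI impI) (auto simp: W_formula_eq_mode_inner D_def)
  ultimately have "((\<lambda>(x, y). W_formula T c lamk x y) \<longlongrightarrow> mode_inner T c lamk \<omega> \<omega>') (at (\<omega>, \<omega>') within D)"
    by (rule Lim_transform_eventually)
  moreover have "at (\<omega>, \<omega>') within D \<noteq> bot"
    using punctured_quadrant_limit_point[OF assms, of a] by (simp add: D_def trivial_limit_within)
  ultimately show ?thesis
    using False unfolding W_def Let_def a_def[symmetric] D_def by (auto intro!: tendsto_Lim)
qed

lemma continuous_on_W:
  "continuous_on ({0<..} \<times> {0<..}) (\<lambda>(\<omega>, \<omega>'). W T c lamk \<omega> \<omega>')"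
  by (rule continuous_on_eq[OF continuous_on_mode_inner[of _ T c lamk]]) (auto simp: W_eq_mode_inner)

section \<open>Decay of the kernel in both frequencies\<close>

text \<open>Multiplying out the integrand leaves cos cos / lamk, two mixed terms and 2 lamk times
  the product of the modes. The first is kept apart, because orthogonality will remove it off the
  diagonal. Each mixed term is controlled by \<open>cos_wave_mode_bound\<close>; the last one
  contributes 2 lamk (2 T c^2)^2 T.\<close>

lemma mode_inner_bound:
  assumes "0 < \<omega>" "0 < \<omega>'"
  shows "\<bar>mode_inner T c lamk \<omega> \<omega>'\<bar> \<le> \<bar>integral {0..T} (\<lambda>t. cos (\<omega> * t) * cos (\<omega>' * t))\<bar> / lamk
    + (2 * (3 * T * c\<^sup>2 + 2 * T^3 * a\<^sup>2 * c\<^sup>2) + 8 * lamk * T^3 * c^4) / (\<omega> * \<omega>')"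
proof -
  define w where "w = wave_mode c a"
  have cw: "continuous_on X (w x)" for x X unfolding w_def by (intro continuous_intros)
  have cI: "((\<lambda>t. f t * g t) has_integral integral {0..T} (\<lambda>t. f t * g t)) {0..T}"
    if "continuous_on {0..T} f" "continuous_on {0..T} g" for f g :: "real \<Rightarrow> real"
    by (intro integrable_integral integrable_continuous_real continuous_intros that)
  have cc: "continuous_on {0..T} (\<lambda>t. cos (x * t))" for x :: real by (intro continuous_intros)
  have "mode_integrand c lamk a \<omega> \<omega>' t = 1 / lamk * (cos (\<omega> * t) * cos (\<omega>' * t))
      - cos (\<omega> * t) * w \<omega>' t - cos (\<omega>' * t) * w \<omega> t + 2 * lamk * (w \<omega> t * w \<omega>' t)" for t
    using lamk by (simp add: mode_integrand_def w_def field_simps)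
  moreover have "((\<lambda>t. 1 / lamk * (cos (\<omega> * t) * cos (\<omega>' * t))
      - cos (\<omega> * t) * w \<omega>' t - cos (\<omega>' * t) * w \<omega> t + 2 * lamk * (w \<omega> t * w \<omega>' t)) has_integral
      (1 / lamk * integral {0..T} (\<lambda>t. cos (\<omega> * t) * cos (\<omega>' * t))
      - integral {0..T} (\<lambda>t. cos (\<omega> * t) * w \<omega>' t) - integral {0..T} (\<lambda>t. cos (\<omega>' * t) * w \<omega> t)
      + 2 * lamk * integral {0..T} (\<lambda>t. w \<omega> t * w \<omega>' t))) {0..T}"
    by (intro has_integral_add has_integral_diff has_integral_mult_right cI cw cc)
  ultimately have eq: "mode_inner T c lamk \<omega> \<omega>' = 1 / lamk * integral {0..T} (\<lambda>t. cos (\<omega> * t) * cos (\<omega>' * t))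
      - integral {0..T} (\<lambda>t. cos (\<omega> * t) * w \<omega>' t) - integral {0..T} (\<lambda>t. cos (\<omega>' * t) * w \<omega> t)
      + 2 * lamk * integral {0..T} (\<lambda>t. w \<omega> t * w \<omega>' t)"
    unfolding mode_inner_def a_def[symmetric]
    by - (rule integral_unique, erule has_integral_eq[rotated], simp only:)
  have b1: "\<bar>integral {0..T} (\<lambda>t. cos (\<omega> * t) * w \<omega>' t)\<bar> \<le> (3 * T * c\<^sup>2 + 2 * T^3 * a\<^sup>2 * c\<^sup>2) / (\<omega> * \<omega>')"
    unfolding w_def by (rule cos_wave_mode_bound) (use assms T sqrt_mu_pos in auto)
  have b2: "\<bar>integral {0..T} (\<lambda>t. cos (\<omega>' * t) * w \<omega> t)\<bar> \<le> (3 * T * c\<^sup>2 + 2 * T^3 * a\<^sup>2 * c\<^sup>2) / (\<omega>' * \<omega>)"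
    unfolding w_def by (rule cos_wave_mode_bound) (use assms T sqrt_mu_pos in auto)
  have "norm (w \<omega> t * w \<omega>' t) \<le> 2 * T * c\<^sup>2 / \<omega> * (2 * T * c\<^sup>2 / \<omega>')" if "t \<in> {0..T}" for t
    unfolding real_norm_def abs_mult w_def
    using wave_mode_bound[OF T sqrt_mu_pos _ that] assms T by (intro mult_mono) auto
  then have "\<bar>integral {0..T} (\<lambda>t. w \<omega> t * w \<omega>' t)\<bar> \<le> 2 * T * c\<^sup>2 / \<omega> * (2 * T * c\<^sup>2 / \<omega>') * (T - 0)"
    using integral_bound[of 0 T "\<lambda>t. w \<omega> t * w \<omega>' t"] T
    by (force intro!: continuous_intros cw)
  then have "2 * lamk * \<bar>integral {0..T} (\<lambda>t. w \<omega> t * w \<omega>' t)\<bar>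
      \<le> 2 * lamk * (2 * T * c\<^sup>2 / \<omega> * (2 * T * c\<^sup>2 / \<omega>') * (T - 0))"
    using lamk by (intro mult_left_mono) auto
  also have "\<dots> = 8 * lamk * T^3 * c^4 / (\<omega> * \<omega>')"
    by (simp add: power2_eq_square power3_eq_cube power4_eq_xxxx)
  finally have b3: "\<bar>2 * lamk * integral {0..T} (\<lambda>t. w \<omega> t * w \<omega>' t)\<bar> \<le> 8 * lamk * T^3 * c^4 / (\<omega> * \<omega>')"
    using lamk by (simp add: abs_mult)
  have b0: "\<bar>1 / lamk * integral {0..T} (\<lambda>t. cos (\<omega> * t) * cos (\<omega>' * t))\<bar>
      = \<bar>integral {0..T} (\<lambda>t. cos (\<omega> * t) * cos (\<omega>' * t))\<bar> / lamk"
    using lamk by (simp add: abs_mult)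
  have sum: "(2 * (3 * T * c\<^sup>2 + 2 * T^3 * a\<^sup>2 * c\<^sup>2) + 8 * lamk * T^3 * c^4) / (\<omega> * \<omega>')
      = (3 * T * c\<^sup>2 + 2 * T^3 * a\<^sup>2 * c\<^sup>2) / (\<omega> * \<omega>') + (3 * T * c\<^sup>2 + 2 * T^3 * a\<^sup>2 * c\<^sup>2) / (\<omega>' * \<omega>)
        + 8 * lamk * T^3 * c^4 / (\<omega> * \<omega>')"
    by (simp add: add_divide_distrib mult.commute)
  have tri: "\<bar>p - q - r + s\<bar> \<le> \<bar>p\<bar> + (\<bar>q\<bar> + \<bar>r\<bar> + \<bar>s\<bar>)" for p q r s :: real by linarith
  show ?thesis
    unfolding eq sum
    by (rule order_trans[OF tri]) (use b0 b1 b2 b3 in linarith)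
qed

section \<open>The diagonal of the kernel\<close>

text \<open>Twice the frequency times T is an odd multiple of pi.\<close>

lemma sinc_freq: "sinc (2 * freq T j * T) = 0" "sin (freq T j * 2 * T) = 0"
proof -
  have "2 * freq T j * T = real (2 * j + 1) * pi" using T by (simp add: freq_def field_simps)
  moreover have "sin (real (2 * j + 1) * pi) = 0" by (simp only: sin_npi)
  ultimately show "sinc (2 * freq T j * T) = 0" "sin (freq T j * 2 * T) = 0"
    using T freq_pos[OF T, of j] by (auto simp: mult.commute)
qed

lemma Vstar_norm_cos:
  "(Vstar_norm T lamk (\<lambda>t. cos (\<omega> * t)))\<^sup>2 = T / (2 * lamk) * (1 + sinc (2 * \<omega> * T))"
proof -
  have "(LINT t|lebesgue_on {0<..<T}. (norm (cos (\<omega> * t)))\<^sup>2) = integral {0..T} (\<lambda>t. cos (\<omega> * t) * cos (\<omega> * t))"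
    by (subst LINT_lebesgue_on_continuous)
      (auto intro!: continuous_intros simp: power2_eq_square)
  also have "\<dots> = T / 2 * (sinc ((\<omega> + \<omega>) * T) + sinc ((\<omega> - \<omega>) * T))"
    using T by (intro integral_cos_cos) simp
  also have "\<dots> = T / 2 * (1 + sinc (2 * \<omega> * T))" by simp
  finally have "(LINT t|lebesgue_on {0<..<T}. (norm (cos (\<omega> * t)))\<^sup>2) = T / 2 * (1 + sinc (2 * \<omega> * T))" .
  moreover have "(sqrt (1 / lamk * (sqrt x)\<^sup>2))\<^sup>2 = x / lamk" if "0 \<le> x" for x
    using lamk that by simp
  moreover have "0 \<le> (LINT t|lebesgue_on {0<..<T}. (norm (cos (\<omega> * t)))\<^sup>2)" by simp
  ultimately show ?thesis
    unfolding Vstar_norm_def L2_norm_def by (simp only: divide_divide_eq_left times_divide_eq_left)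
qed

text \<open>Integrating directly avoids the second-order 0/0 limit of the closed formula. At
  resonance lamk times the mode is a t sin(a t) / 2, so an antiderivative can be written down with
  the double-angle formulas; the one chosen vanishes at 0.\<close>

lemma mode_inner_resonant:
  "mode_inner T c lamk a a = 1 / lamk * (T / 2 + sin (2 * a * T) / (4 * a) + a\<^sup>2 * T^3 / 12
     - a * T\<^sup>2 * sin (2 * a * T) / 8 + T * cos (2 * a * T) / 8 - sin (2 * a * T) / (16 * a))"
proof -
  define F where "F t = 1 / lamk * (t / 2 + sin (2 * a * t) / (4 * a) + a\<^sup>2 * t^3 / 12
     - a * t\<^sup>2 * sin (2 * a * t) / 8 + t * cos (2 * a * t) / 8 - sin (2 * a * t) / (16 * a))" for t
  have a0: "0 < a" by (rule sqrt_mu_pos)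
  have "(F has_real_derivative mode_integrand c lamk a a a t) (at t)" for t
  proof -
    define s k where "s = sin (a * t)" and "k = cos (a * t)"
    have sk: "s\<^sup>2 = 1 - k\<^sup>2" by (simp add: s_def k_def sin_squared_eq)
    have s2: "sin (2 * a * t) = 2 * s * k" and k2: "cos (2 * a * t) = 2 * k\<^sup>2 - 1"
      using sin_double[of "a * t"] cos_double_cos[of "a * t"] by (simp_all add: s_def k_def mult.assoc)
    have lw: "lamk * wave_mode c a a t = a * t * s / 2"
      using sqrt_mu_power2 a0 by (simp add: wave_mode_resonant[OF a0] s_def field_simps power2_eq_square)
    have "mode_integrand c lamk a a a t
        = 1 / lamk * ((lamk * wave_mode c a a t)\<^sup>2 + (k - lamk * wave_mode c a a t)\<^sup>2)"
      using lamk by (simp add: mode_integrand_def k_def field_simps power2_eq_square)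
    also have "\<dots> = 1 / lamk * (a\<^sup>2 * t\<^sup>2 * s\<^sup>2 / 2 + k\<^sup>2 - a * t * s * k)"
    proof -
      have "(a * t * s / 2)\<^sup>2 + (k - a * t * s / 2)\<^sup>2 = a\<^sup>2 * t\<^sup>2 * s\<^sup>2 / 2 + k\<^sup>2 - a * t * s * k"
        by (simp add: power2_eq_square field_simps)
      then show ?thesis unfolding lw by (simp only:)
    qed
    finally have rhs: "mode_integrand c lamk a a a t = 1 / lamk * (a\<^sup>2 * t\<^sup>2 * s\<^sup>2 / 2 + k\<^sup>2 - a * t * s * k)" .
    have "(F has_real_derivative 1 / lamk * (1 / 2 + 2 * a * cos (2 * a * t) / (4 * a) + a\<^sup>2 * (3 * t\<^sup>2) / 12
       - (a * (2 * t) * sin (2 * a * t) + a * t\<^sup>2 * (2 * a * cos (2 * a * t))) / 8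
       + (cos (2 * a * t) - t * (2 * a * sin (2 * a * t))) / 8 - 2 * a * cos (2 * a * t) / (16 * a))) (at t)"
      unfolding F_def using a0 lamk
      by (auto intro!: derivative_eq_intros simp: power2_eq_square) (simp add: field_simps)
    also have "1 / lamk * (1 / 2 + 2 * a * cos (2 * a * t) / (4 * a) + a\<^sup>2 * (3 * t\<^sup>2) / 12
       - (a * (2 * t) * sin (2 * a * t) + a * t\<^sup>2 * (2 * a * cos (2 * a * t))) / 8
       + (cos (2 * a * t) - t * (2 * a * sin (2 * a * t))) / 8 - 2 * a * cos (2 * a * t) / (16 * a))
      = mode_integrand c lamk a a a t"
    proof -
      have "1 / 2 + 2 * a * (2 * k\<^sup>2 - 1) / (4 * a) + a\<^sup>2 * (3 * t\<^sup>2) / 12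
         - (a * (2 * t) * (2 * s * k) + a * t\<^sup>2 * (2 * a * (2 * k\<^sup>2 - 1))) / 8
         + (2 * k\<^sup>2 - 1 - t * (2 * a * (2 * s * k))) / 8 - 2 * a * (2 * k\<^sup>2 - 1) / (16 * a)
        = a\<^sup>2 * t\<^sup>2 * (1 - k\<^sup>2) / 2 + k\<^sup>2 - a * t * s * k"
        using a0 by (simp add: field_simps power2_eq_square)
      then show ?thesis unfolding rhs s2 k2 sk by (simp only:)
    qed
    finally show ?thesis .
  qed
  from integral_of_derivative[OF _ this, of T] T show ?thesis
    unfolding mode_inner_def a_def[symmetric] by (simp add: F_def)
qed

text \<open>At \<omega>_j the sinc of 2 \<omega> T vanishes, so the squared norm of the cosine is T
  / (2 lamk) and the denominator in \<open>C_const\<close> that contains this sinc is 1.\<close>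

lemma W_diagonal:
  "W T c lamk (freq T j) (freq T j) =
    (1 + C_const T c lamk (freq T j)) * (Vstar_norm T lamk (\<lambda>t. cos (freq T j * t)))\<^sup>2"
proof -
  define \<omega> where "\<omega> = freq T j"
  have \<omega>: "0 < \<omega>" and s0: "sinc (2 * \<omega> * T) = 0"
    unfolding \<omega>_def by (rule freq_pos[OF T], rule sinc_freq(1))
  have V: "(Vstar_norm T lamk (\<lambda>t. cos (\<omega> * t)))\<^sup>2 = T / (2 * lamk)"
    by (simp only: Vstar_norm_cos s0) simp
  have mu: "mu c lamk = a\<^sup>2" using sqrt_mu_power2 by (simp add: mu_def)
  have W: "W T c lamk \<omega> \<omega> = mode_inner T c lamk \<omega> \<omega>" using W_eq_mode_inner \<omega> by simp
  show ?thesis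
  proof (cases "\<omega> = a")
    case True
    have sin0: "sin (2 * a * T) = 0"
      using sinc_freq(2)[of j] True by (simp add: \<omega>_def[symmetric] mult_ac)
    have C: "C_const T c lamk \<omega> = a\<^sup>2 * (T\<^sup>2 / 6 + 1 / (4 * a\<^sup>2) * cos (2 * a * T))"
      unfolding C_const_def Let_def a_def[symmetric] unfolding mu True
      using sin0 T sqrt_mu_pos by simp
    \<comment> \<open>Factoring out T / (2 lamk) leaves 1 + a^2 T^2 / 6 + cos(2 a T) / 4; the cosine
      enters with a positive sign.\<close>
    have M: "mode_inner T c lamk a a = 1 / lamk * (T / 2 + a\<^sup>2 * T^3 / 12 + T * cos (2 * a * T) / 8)"
      unfolding mode_inner_resonant sin0 by simp
    show ?thesis
      unfolding \<omega>_def[symmetric] V W C unfolding True M using sqrt_mu_pos lamk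
      by (simp add: field_simps power2_eq_square power3_eq_cube)
  next
    case False
    define S where "S = (\<lambda>x::real. sinc x)"
    have nz: "a\<^sup>2 - \<omega>\<^sup>2 \<noteq> 0" using False sqrt_mu_pos \<omega> by (simp add: power2_eq_iff)
    have sq: "sqrt (a\<^sup>2) = a" using sqrt_mu_pos by simp
    have S1: "S ((\<omega> + \<omega>) * T) = 0" "S ((\<omega> - \<omega>) * T) = 1" "S (2 * \<omega> * T) = 0"
      using s0 by (auto simp: S_def)
    have "W T c lamk \<omega> \<omega> = T / (2 * lamk) * (S ((\<omega> + \<omega>) * T) + S ((\<omega> - \<omega>) * T))
     + c\<^sup>2 * T / ((a\<^sup>2 - \<omega>\<^sup>2) * (a\<^sup>2 - \<omega>\<^sup>2)) * (a\<^sup>2 * (1 + S (2 * a * T))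
        + (\<omega>\<^sup>2 + \<omega>\<^sup>2) / 2 * (S ((\<omega> - \<omega>) * T) + S ((\<omega> + \<omega>) * T))
        - (a\<^sup>2 + \<omega>\<^sup>2) / 2 * (S ((a - \<omega>) * T) + S ((a + \<omega>) * T))
        - (a\<^sup>2 + \<omega>\<^sup>2) / 2 * (S ((a - \<omega>) * T) + S ((a + \<omega>) * T)))"
      unfolding W_def W_formula_def Let_def mu sq S_def using False by (simp only: if_True simp_thms)
    moreover have "C_const T c lamk \<omega> = 2 * a\<^sup>2 / (1 + S (2 * \<omega> * T)) * ((a\<^sup>2 + \<omega>\<^sup>2) / (a\<^sup>2 - \<omega>\<^sup>2)\<^sup>2) *
       (1 - S ((a + \<omega>) * T) - S ((a - \<omega>) * T)
        + (a\<^sup>2 * S (2 * a * T) + \<omega>\<^sup>2 * S (2 * \<omega> * T)) / (a\<^sup>2 + \<omega>\<^sup>2))"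
      unfolding C_const_def Let_def mu sq S_def using False by (simp only: if_False simp_thms)
    moreover have "a\<^sup>2 + \<omega>\<^sup>2 \<noteq> 0" using \<omega> by (simp add: sum_power2_eq_zero_iff)
    moreover have "c\<^sup>2 = a\<^sup>2 / lamk" using sqrt_mu_power2 lamk by simp
    \<comment> \<open>Here m, p, d stand for a^2, \<omega>^2 and a^2 - \<omega>^2, and s1, s2, s4
      for the sinc values at (a + \<omega>) T, (a - \<omega>) T and 2 a T.\<close>
    moreover have "T / (2 * lamk) * (0 + 1) + m / lamk * T / (d * d) * (m * (1 + s4)
        + (p + p) / 2 * (1 + 0) - (m + p) / 2 * (s2 + s1) - (m + p) / 2 * (s2 + s1))
      = (1 + 2 * m / (1 + 0) * ((m + p) / d\<^sup>2) * (1 - s1 - s2 + (m * s4 + p * 0) / (m + p)))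
        * (T / (2 * lamk))"
      if "d \<noteq> 0" "m + p \<noteq> 0" for d m p s1 s2 s4
    proof -
      define x y where "x = 1 - s1 - s2" and "y = m * s4 + p * 0"
      have "(m + p) / d\<^sup>2 * (y / (m + p)) = y / d\<^sup>2" using that by simp
      then have "(m + p) / d\<^sup>2 * (x + y / (m + p)) = ((m + p) * x + y) / d\<^sup>2"
        by (simp only: distrib_left add_divide_distrib[of "(m + p) * x" y] times_divide_eq_left)
      moreover have "2 * m / (1 + 0) * ((m + p) / d\<^sup>2) * (x + y / (m + p))
          = 2 * m * ((m + p) / d\<^sup>2 * (x + y / (m + p)))" by simp
      ultimately show ?thesis
        unfolding x_def[symmetric] y_def[symmetric]
        using that(1) lamk by (simp only:) (simp add: x_def y_def field_simps power2_eq_square)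
    qed
    ultimately show ?thesis
      unfolding \<omega>_def[symmetric] V S1 using nz by simp
  qed
qed

end

section \<open>Weak derivatives\<close>

lemma AE_eq_imp_integral_eq:
  fixes f g :: "real \<Rightarrow> real"
  assumes "AE t in lebesgue_on {0<..<T}. f t = g t" "s \<in> {0..T}"
  shows "integral {0..s} f = integral {0..s} g"
proof -
  have "AE t in lebesgue. t \<in> {0<..<T} \<longrightarrow> f t = g t"
    using assms(1) by (simp add: AE_restrict_space_iff)
  then obtain N where N: "negligible N" "{t. \<not> (t \<in> {0<..<T} \<longrightarrow> f t = g t)} \<subseteq> N"
    unfolding eventually_ae_filter_negligible by auto
  show ?thesis
  proof (rule integral_spike)
    \<comment> \<open>The hypothesis concerns the open interval only, so the endpoints join the
      exceptional set.\<close>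
    show "negligible (N \<union> {0, T})" using N(1) by (intro negligible_Un) auto
    show "g t = f t" if "t \<in> {0..s} - (N \<union> {0, T})" for t
    proof -
      have "t \<in> {0<..<T}" using that assms(2) by auto
      then show ?thesis using N(2) that by auto
    qed
  qed
qed

lemma L2_absolutely_integrable_on:
  fixes v :: "real \<Rightarrow> real"
  assumes "v \<in> L2_space {0<..<T}"
  shows "integrable (lebesgue_on {0<..<T}) v" "v absolutely_integrable_on {0..T}"
proof -
  have "(\<lambda>_. 1 :: real) \<in> L2_space {0<..<T}" by (rule continuous_in_L2_space) simp
  from integrable_mult_L2[OF assms this] show i: "integrable (lebesgue_on {0<..<T}) v" by simp
  then have "v absolutely_integrable_on {0<..<T}"
    by (simp add: integrable_restrict_space set_integrable_def)
  then show "v absolutely_integrable_on {0..T}"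
    by (rule absolutely_integrable_spike_set) (auto intro: negligible_subset[of "{0, T}"])
qed

lemma L2_integrable_on:
  fixes v :: "real \<Rightarrow> real"
  assumes "v \<in> L2_space {0<..<T}" "0 \<le> r" "s \<le> T"
  shows "v integrable_on {r..s}"
  using L2_absolutely_integrable_on(2)[OF assms(1)] assms(2,3)
  by (meson absolutely_integrable_on_def integrable_on_subinterval atLeastatMost_subset_iff)

lemma abs_integral_le_LINT:
  fixes v :: "real \<Rightarrow> real"
  assumes v: "v \<in> L2_space {0<..<T}" and s: "s \<in> {0..T}"
  shows "\<bar>integral {0..s} v\<bar> \<le> (LINT t|lebesgue_on {0<..<T}. \<bar>v t\<bar>)"
proof -
  have a: "v absolutely_integrable_on {0..T}" by (rule L2_absolutely_integrable_on[OF v])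
  then have n: "(\<lambda>t. \<bar>v t\<bar>) integrable_on {0..T}"
    by (auto simp: absolutely_integrable_on_def)
  have "\<bar>integral {0..s} v\<bar> \<le> integral {0..s} (\<lambda>t. \<bar>v t\<bar>)"
    using integral_norm_bound_integral[of v "{0..s}" "\<lambda>t. \<bar>v t\<bar>"] L2_integrable_on[OF v] s
      integrable_on_subinterval[OF n, of 0 s] by auto
  also have "\<dots> \<le> integral {0..T} (\<lambda>t. \<bar>v t\<bar>)"
    using s by (intro integral_subset_le integrable_on_subinterval[OF n]) auto
  also have "\<dots> = (LINT t|lebesgue_on {0<..<T}. \<bar>v t\<bar>)"
    using lebesgue_integral_eq_integral[of "{0<..<T}" "\<lambda>t. \<bar>v t\<bar>"] L2_absolutely_integrable_on(1)[OF v]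
    by (simp add: integral_open_interval_real)
  finally show ?thesis .
qed

section \<open>A continuously differentiable step and one-sided mollifiers\<close>

text \<open>The primitive of the tent function on [0, 1] with peak 2 at 1/2 and integral 1.
  Piecewise quadratic pieces suffice because test functions are only required to be C^1.\<close>

definition smooth_step :: "real \<Rightarrow> real" where
  "smooth_step x = 2 * (max 0 x)\<^sup>2 - 4 * (max 0 (x - 1 / 2))\<^sup>2 + 2 * (max 0 (x - 1))\<^sup>2"

definition smooth_step_deriv :: "real \<Rightarrow> real" where
  "smooth_step_deriv x = 4 * max 0 x - 8 * max 0 (x - 1 / 2) + 4 * max 0 (x - 1)"

lemma smooth_step_eq:
  "x \<le> 0 \<Longrightarrow> smooth_step x = 0" "1 \<le> x \<Longrightarrow> smooth_step x = 1"
  by (auto simp: smooth_step_def max_def power2_eq_square algebra_simps)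

lemma smooth_step_deriv_nonneg: "0 \<le> smooth_step_deriv x"
  by (auto simp: smooth_step_deriv_def max_def)

lemma smooth_step_deriv_eq_0: "x \<le> 0 \<or> 1 \<le> x \<Longrightarrow> smooth_step_deriv x = 0"
  by (auto simp: smooth_step_deriv_def max_def)

lemma DERIV_max_0_power2: "((\<lambda>x. (max 0 x)\<^sup>2) has_real_derivative 2 * max 0 x) (at (x::real))"
proof (cases x "0::real" rule: linorder_cases)
  case less
  show ?thesis
    by (rule has_field_derivative_transform_within_open[of "\<lambda>_. 0" _ _ "{..<0}"]) (use less in auto)
next
  case equal
  have "\<bar>(max 0 h)\<^sup>2 / h\<bar> \<le> \<bar>h\<bar>" for h :: real
    by (auto simp: max_def power2_eq_square)
  then have "((\<lambda>h::real. (max 0 h)\<^sup>2 / h) \<longlongrightarrow> 0) (at 0)"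
    using tendsto_rabs_zero[OF tendsto_ident_at[of "0::real" UNIV]]
    by (rule_tac Lim_null_comparison[OF always_eventually]) simp_all
  then show ?thesis by (simp add: equal DERIV_def)
next
  case greater
  show ?thesis
    by (rule has_field_derivative_transform_within_open[of "\<lambda>x. x\<^sup>2" _ _ "{0<..}"])
      (use greater in \<open>auto intro!: derivative_eq_intros\<close>)
qed

lemma DERIV_smooth_step: "(smooth_step has_real_derivative smooth_step_deriv x) (at x)"
proof -
  have "((\<lambda>x. (max 0 (x - r))\<^sup>2) has_real_derivative 2 * max 0 (x - r)) (at x)" for r :: real
  proof -
    have "((\<lambda>x. x - r) has_real_derivative 1) (at x)"
      by (auto intro!: derivative_eq_intros)
    from DERIV_chain2[OF DERIV_max_0_power2 this] show ?thesis by simp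
  qed
  note d = this[of 0, simplified] this[of "1 / 2"] this[of 1]
  show ?thesis
    unfolding smooth_step_def[abs_def] smooth_step_deriv_def
    by (rule derivative_eq_intros d refl)+ simp
qed

lemma smooth_step_bounds: "0 \<le> smooth_step x" "smooth_step x \<le> 1"
proof -
  have mono: "smooth_step y \<le> smooth_step z" if "y \<le> z" for y z
    using that DERIV_nonneg_imp_nondecreasing[of y z smooth_step]
      DERIV_smooth_step smooth_step_deriv_nonneg by blast
  show "0 \<le> smooth_step x" using mono[of "min x 0" x] smooth_step_eq(1)[of "min x 0"] by simp
  show "smooth_step x \<le> 1" using mono[of x "max x 1"] smooth_step_eq(2)[of "max x 1"] by simp
qed

lemma continuous_on_smooth_step_deriv [continuous_intros]:
  "continuous_on S f \<Longrightarrow> continuous_on S (\<lambda>x. smooth_step_deriv (f x))"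
  unfolding smooth_step_deriv_def by (intro continuous_intros)

lemma DERIV_smooth_step_scaled:
  "((\<lambda>x. smooth_step (b * (x - s))) has_real_derivative b * smooth_step_deriv (b * (x - s))) (at x)"
proof -
  have "((\<lambda>x. b * (x - s)) has_real_derivative b) (at x)"
    by (auto intro!: derivative_eq_intros)
  from DERIV_chain2[OF DERIV_smooth_step this] show ?thesis by (simp add: mult.commute)
qed

lemma continuous_on_smooth_step [continuous_intros]:
  "continuous_on S f \<Longrightarrow> continuous_on S (\<lambda>x. smooth_step (f x))"
  unfolding smooth_step_def by (intro continuous_intros)

lemma mollifier_tendsto:
  fixes U :: "real \<Rightarrow> real"
  assumes U: "continuous_on {0..T} U" and s: "0 \<le> s" "s < T"
  shows "(\<lambda>n. integral {0..T} (\<lambda>x. U x * (real n * smooth_step_deriv (real n * (x - s))))) \<longlonglongrightarrow> U s"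
proof (rule LIMSEQ_I)
  fix e :: real assume "0 < e"
  define k where "k n x = real n * smooth_step_deriv (real n * (x - s))" for n x
  have k0: "0 \<le> k n x" for n x by (simp add: k_def smooth_step_deriv_nonneg)
  have ck: "continuous_on X (k n)" for n X unfolding k_def by (intro continuous_intros)
  have "\<exists>d>0. \<forall>x\<in>{0..T}. dist x s < d \<longrightarrow> dist (U x) (U s) < e / 2"
    using U s \<open>0 < e\<close> unfolding continuous_on_iff by (meson atLeastAtMost_iff half_gt_zero less_imp_le)
  then obtain d where d: "d > 0" "\<And>x. x \<in> {0..T} \<Longrightarrow> \<bar>x - s\<bar> < d \<Longrightarrow> \<bar>U x - U s\<bar> < e / 2"
    by (auto simp: dist_real_def)
  \<comment> \<open>For n \<ge> N the support of the kernel lies both within distance d of s and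
    inside [0, T], so no mass is lost.\<close>
  obtain N :: nat where N: "1 / min d (T - s) < real N" using reals_Archimedean2 by blast
  have "norm (integral {0..T} (\<lambda>x. U x * k n x) - U s) < e" if "n \<ge> N" for n
  proof -
    have m: "0 < min d (T - s)" using d s by simp
    have "1 / min d (T - s) < real n" using N that by linarith
    then have "1 < real n * min d (T - s)" using m by (simp add: divide_less_eq)
    moreover have "real n * min d (T - s) \<le> real n * d" "real n * min d (T - s) \<le> real n * (T - s)"
      by (auto intro!: mult_left_mono)
    ultimately have nd: "1 < real n * d" and nT: "1 < real n * (T - s)" by linarith+
    have T0: "0 \<le> T" using s by simp
    have one: "integral {0..T} (k n) = 1"
      using integral_of_derivative[OF T0 DERIV_smooth_step_scaled, of "real n" s] nT s
        smooth_step_eq(1)[of "real n * (0 - s)"] smooth_step_eq(2)[of "real n * (T - s)"]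
      by (simp add: k_def[abs_def])
    have kk: "k n integrable_on {0..T}" by (intro integrable_continuous_real ck)
    have "integral {0..T} (\<lambda>x. U x * k n x) - U s = integral {0..T} (\<lambda>x. U x * k n x) - integral {0..T} (\<lambda>x. U s * k n x)"
      using one by simp
    also have "\<dots> = integral {0..T} (\<lambda>x. U x * k n x - U s * k n x)"
      by (intro integral_diff[symmetric] integrable_continuous_real continuous_intros U ck)
    finally have "norm (integral {0..T} (\<lambda>x. U x * k n x) - U s)
        = norm (integral {0..T} (\<lambda>x. U x * k n x - U s * k n x))" by simp
    also have "\<dots> \<le> integral {0..T} (\<lambda>x. e / 2 * k n x)"
    proof (rule integral_norm_bound_integral)
      fix x assume x: "x \<in> {0..T}"
      show "norm (U x * k n x - U s * k n x) \<le> e / 2 * k n x"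
      proof (cases "\<bar>x - s\<bar> < d")
        case True
        have "norm (U x * k n x - U s * k n x) = \<bar>U x - U s\<bar> * k n x"
          using k0[of n x] by (simp add: left_diff_distrib[symmetric] abs_mult)
        also have "\<dots> \<le> e / 2 * k n x" using d(2)[OF x True] k0 by (intro mult_right_mono) auto
        finally show ?thesis .
      next
        case False
        have "real n * (x - s) \<le> 0 \<or> 1 \<le> real n * (x - s)"
        proof (cases "x \<le> s")
          case True then show ?thesis by (simp add: mult_nonneg_nonpos)
        next
          case False
          with \<open>\<not> \<bar>x - s\<bar> < d\<close> have "real n * d \<le> real n * (x - s)" by (intro mult_left_mono) auto
          with nd show ?thesis by linarith
        qed
        then show ?thesis by (simp add: k_def smooth_step_deriv_eq_0)
      qed
    qed (intro integrable_continuous_real continuous_intros U ck)+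
    also have "\<dots> = e / 2" using one by simp
    finally show ?thesis using \<open>0 < e\<close> by simp
  qed
  then show "\<exists>N. \<forall>n\<ge>N. norm (integral {0..T} (\<lambda>x. U x * (real n * smooth_step_deriv (real n * (x - s)))) - U s) < e"
    unfolding k_def by blast
qed

text \<open>A smoothed indicator of the interval from s to t whose derivative is the difference of
  two mollifier kernels: testing with it probes the values near s and t.\<close>

lemma test_function_smooth_bump:
  assumes "0 < s" "s < t" "0 < b" "t + 1 / b < T"
  shows "test_function {0<..<T} (\<lambda>x. smooth_step (b * (x - s)) - smooth_step (b * (x - t)))
    (\<lambda>x. b * smooth_step_deriv (b * (x - s)) - b * smooth_step_deriv (b * (x - t)))"
proof -
  have "x \<in> {s..t + 1 / b}" if "smooth_step (b * (x - s)) - smooth_step (b * (x - t)) \<noteq> 0" for x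
  proof (rule ccontr)
    assume "x \<notin> {s..t + 1 / b}"
    then consider "x < s" | "t + 1 / b < x" by force
    then show False
    proof cases
      case 1
      then have "b * (x - s) \<le> 0" "b * (x - t) \<le> 0" using assms by (auto intro!: mult_nonneg_nonpos)
      with that show False by (simp add: smooth_step_eq)
    next
      case 2
      then have "1 \<le> b * (x - t)" using assms by (simp add: field_simps)
      moreover have "b * (x - t) \<le> b * (x - s)" using assms by (intro mult_left_mono) auto
      ultimately show False using that by (simp add: smooth_step_eq)
    qed
  qed
  then have "closure {x. smooth_step (b * (x - s)) - smooth_step (b * (x - t)) \<noteq> 0} \<subseteq> {s..t + 1 / b}"
    by (intro closure_minimal) auto
  moreover from bounded_subset[OF compact_imp_bounded[OF compact_Icc] this]
  have "compact (closure {x. smooth_step (b * (x - s)) - smooth_step (b * (x - t)) \<noteq> 0})"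
    by (simp only: compact_eq_bounded_closed closed_closure simp_thms)
  moreover have "{s..t + 1 / b} \<subseteq> {0<..<T}" using assms by auto
  ultimately show ?thesis
    unfolding test_function_def gderiv_deriv
    by (auto intro!: continuous_intros DERIV_diff DERIV_smooth_step_scaled)
qed

section \<open>From weak derivatives to integral equations\<close>

text \<open>Test with the bumps and let n grow. The side with \<phi>' tends to U s - U t because the
  kernels concentrate at s and t; the side with \<phi> tends to minus the integral of v over (s, t]
  by dominated convergence.\<close>

lemma weak_deriv_increment:
  assumes wd: "has_weak_deriv T w v" and U: "continuous_on {0..T} U"
    and ae: "AE t in lebesgue_on {0<..<T}. w t = U t"
    and st: "0 < s" "s < t" "t < T"
  shows "U t - U s = integral {s..t} v"
proof -
  have wL: "w \<in> L2_space {0<..<T}" and vL: "v \<in> L2_space {0<..<T}"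
    and test: "\<And>\<phi> \<phi>'. test_function {0<..<T} \<phi> \<phi>' \<Longrightarrow>
        (LINT t|lebesgue_on {0<..<T}. w t * \<phi>' t) = - (LINT t|lebesgue_on {0<..<T}. v t * \<phi> t)"
    using wd by (auto simp: has_weak_deriv_def)
  have vi: "integrable (lebesgue_on {0<..<T}) v" by (rule L2_absolutely_integrable_on[OF vL])
  define k where "k n r x = real n * smooth_step_deriv (real n * (x - r))" for n r x
  define \<phi> where "\<phi> n x = smooth_step (real n * (x - s)) - smooth_step (real n * (x - t))" for n x
  have ck: "continuous_on X (k n r)" for n r X unfolding k_def by (intro continuous_intros)
  have c\<phi>: "continuous_on X (\<phi> n)" for n X unfolding \<phi>_def by (intro continuous_intros)
  have "(LINT x|lebesgue_on {0<..<T}. w x * (k n s x - k n t x))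
      = integral {0..T} (\<lambda>x. U x * k n s x) - integral {0..T} (\<lambda>x. U x * k n t x)" for n
  proof -
    have "(LINT x|lebesgue_on {0<..<T}. w x * (k n s x - k n t x))
        = (LINT x|lebesgue_on {0<..<T}. U x * (k n s x - k n t x))"
    proof (rule Bochner_Integration.integral_cong_AE)
      have "continuous_on {0..T} (\<lambda>x. k n s x - k n t x)" by (intro continuous_intros ck)
      from borel_measurable_integrable[OF integrable_lebesgue_on_continuous[OF this]]
      show "(\<lambda>x. w x * (k n s x - k n t x)) \<in> borel_measurable (lebesgue_on {0<..<T})"
        using L2_spaceD(1)[OF wL] by measurable
      have "continuous_on {0..T} (\<lambda>x. U x * (k n s x - k n t x))" by (intro continuous_intros ck U)
      from borel_measurable_integrable[OF integrable_lebesgue_on_continuous[OF this]]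
      show "(\<lambda>x. U x * (k n s x - k n t x)) \<in> borel_measurable (lebesgue_on {0<..<T})" .
    qed (use ae in eventually_elim, simp)
    also have "\<dots> = integral {0..T} (\<lambda>x. U x * (k n s x - k n t x))"
      by (intro LINT_lebesgue_on_continuous continuous_intros ck U)
    also have "\<dots> = integral {0..T} (\<lambda>x. U x * k n s x) - integral {0..T} (\<lambda>x. U x * k n t x)"
      unfolding right_diff_distrib
      by (intro integral_diff integrable_continuous_real continuous_intros ck U)
    finally show ?thesis .
  qed
  moreover have "(\<lambda>n. integral {0..T} (\<lambda>x. U x * k n s x) - integral {0..T} (\<lambda>x. U x * k n t x)) \<longlonglongrightarrow> U s - U t"
    unfolding k_def by (intro tendsto_diff mollifier_tendsto U) (use st in auto)
  ultimately have lim1: "(\<lambda>n. LINT x|lebesgue_on {0<..<T}. w x * (k n s x - k n t x)) \<longlonglongrightarrow> U s - U t"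
    by simp
  have step_lim: "(\<lambda>n. smooth_step (real n * y)) \<longlonglongrightarrow> (if 0 < y then 1 else 0)" for y :: real
  proof (cases "0 < y")
    case True
    have "\<forall>\<^sub>F n in sequentially. 1 / y \<le> real n"
      using filterlim_real_sequentially by (auto simp: filterlim_at_top)
    then have "\<forall>\<^sub>F n in sequentially. smooth_step (real n * y) = 1"
      by eventually_elim (use True in \<open>auto intro!: smooth_step_eq simp: divide_le_eq\<close>)
    then show ?thesis using True by (simp add: tendsto_eventually)
  next
    case False
    then have "smooth_step (real n * y) = 0" for n
      by (intro smooth_step_eq) (simp add: mult_nonneg_nonpos)
    then show ?thesis using False by simp
  qed
  have lim2: "(\<lambda>n. LINT x|lebesgue_on {0<..<T}. v x * \<phi> n x)
      \<longlonglongrightarrow> (LINT x|lebesgue_on {0<..<T}. v x * ((if s < x then 1 else 0) - (if t < x then 1 else 0)))"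
  proof (rule integral_dominated_convergence)
    show "integrable (lebesgue_on {0<..<T}) (\<lambda>x. \<bar>v x\<bar>)" using vi by simp
    show "(\<lambda>x. v x * \<phi> n x) \<in> borel_measurable (lebesgue_on {0<..<T})" for n
      using borel_measurable_integrable[OF vi]
        borel_measurable_integrable[OF integrable_lebesgue_on_continuous[OF c\<phi>[of _ n]]] by measurable
    show "(\<lambda>x. v x * ((if s < x then 1 else 0) - (if t < x then 1 else 0))) \<in> borel_measurable (lebesgue_on {0<..<T})"
    proof -
      have "(\<lambda>x. if r < x then 1 else 0 :: real) = indicator {r<..}" for r :: real
        by (auto simp: indicator_def)
      then have "(\<lambda>x. if r < x then 1 else 0 :: real) \<in> borel_measurable (lebesgue_on {0<..<T})" for r :: real
        by (simp only:) (rule measurable_restrict_space1[OF borel_measurable_indicator], simp)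
      then show ?thesis
        by (intro borel_measurable_times borel_measurable_diff borel_measurable_integrable[OF vi])
    qed
    show "AE x in lebesgue_on {0<..<T}. norm (v x * \<phi> n x) \<le> \<bar>v x\<bar>" for n
    proof (rule AE_I2)
      fix x
      have "\<bar>\<phi> n x\<bar> \<le> 1"
        using smooth_step_bounds[of "real n * (x - s)"] smooth_step_bounds[of "real n * (x - t)"]
        unfolding \<phi>_def by linarith
      then show "norm (v x * \<phi> n x) \<le> \<bar>v x\<bar>" by (simp add: abs_mult mult_left_le)
    qed
    show "AE x in lebesgue_on {0<..<T}. (\<lambda>n. v x * \<phi> n x)
        \<longlonglongrightarrow> v x * ((if s < x then 1 else 0) - (if t < x then 1 else 0))"
    proof (rule AE_I2)
      fix x
      show "(\<lambda>n. v x * \<phi> n x) \<longlonglongrightarrow> v x * ((if s < x then 1 else 0) - (if t < x then 1 else 0))"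
        unfolding \<phi>_def using step_lim[of "x - s"] step_lim[of "x - t"] by (intro tendsto_intros) auto
    qed
  qed
  have "\<forall>\<^sub>F n in sequentially. 1 / (T - t) < real n"
    using filterlim_real_sequentially by (auto simp: filterlim_at_top_dense)
  then have "\<forall>\<^sub>F n in sequentially. (LINT x|lebesgue_on {0<..<T}. w x * (k n s x - k n t x))
      = - (LINT x|lebesgue_on {0<..<T}. v x * \<phi> n x)"
  proof eventually_elim
    case (elim n)
    have "0 < 1 / (T - t)" using st by simp
    then have n: "0 < real n" using elim by linarith
    \<comment> \<open>The falling step ends at t + 1/n, which must stay below T; hence the bumps are
      test functions only eventually.\<close>
    have "1 / real n < T - t" using elim n st by (simp add: field_simps)
    then have "test_function {0<..<T} (\<phi> n) (\<lambda>x. k n s x - k n t x)"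
      unfolding \<phi>_def k_def by (intro test_function_smooth_bump) (use st n in auto)
    then show ?case by (rule test)
  qed
  then have "(\<lambda>n. LINT x|lebesgue_on {0<..<T}. w x * (k n s x - k n t x))
      \<longlonglongrightarrow> - (LINT x|lebesgue_on {0<..<T}. v x * ((if s < x then 1 else 0) - (if t < x then 1 else 0)))"
    using tendsto_minus[OF lim2] by (simp add: tendsto_cong)
  with lim1 have eq: "U s - U t
      = - (LINT x|lebesgue_on {0<..<T}. v x * ((if s < x then 1 else 0) - (if t < x then 1 else 0)))"
    by (rule LIMSEQ_unique)
  have "v x * ((if s < x then 1 else 0) - (if t < x then 1 else 0)) = indicator {s<..t} x * v x" for x
    using st by (auto simp: indicator_def)
  then have "(LINT x|lebesgue_on {0<..<T}. v x * ((if s < x then 1 else 0) - (if t < x then 1 else 0)))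
      = (LINT x|lebesgue_on {0<..<T}. indicator {s<..t} x * v x)" by (simp only:)
  also have "\<dots> = integral {0<..<T} (\<lambda>x. indicator {s<..t} x * v x)"
  proof (rule lebesgue_integral_eq_integral)
    have "{s<..t} \<in> sets (lebesgue_on {0<..<T})"
      using st by (auto simp: sets_restrict_space_iff)
    from integrable_mult_indicator[OF this vi]
    show "integrable (lebesgue_on {0<..<T}) (\<lambda>x. indicator {s<..t} x * v x)" by simp
  qed simp
  also have "\<dots> = integral UNIV (\<lambda>x. if x \<in> {s<..t} then v x else 0)"
    unfolding integral_restrict_UNIV[symmetric, of "{0<..<T}"]
    using st by (intro Henstock_Kurzweil_Integration.integral_cong) (auto simp: indicator_def)
  also have "\<dots> = integral {s<..t} v" by (rule integral_restrict_UNIV)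
  also have "\<dots> = integral {s..t} v"
    by (rule integral_subset_negligible) (auto intro: negligible_subset[of "{s}"])
  finally show ?thesis using eq by simp
qed

text \<open>Test functions see only interior points. There the difference R of U and the integral of
  v is constant, and continuity extends this to both endpoints.\<close>

lemma weak_deriv_integral:
  assumes wd: "has_weak_deriv T w v" and U: "continuous_on {0..T} U"
    and ae: "AE t in lebesgue_on {0<..<T}. w t = U t"
    and T: "0 < T" and t: "t \<in> {0..T}"
  shows "U t - U 0 = integral {0..t} v"
proof -
  have vL: "v \<in> L2_space {0<..<T}" using wd by (simp add: has_weak_deriv_def)
  define R where "R t = U t - integral {0..t} v" for t
  have "continuous_on {0..T} R"
    unfolding R_def using L2_integrable_on[OF vL, of 0 T]
    by (intro continuous_intros U indefinite_integral_continuous_1) auto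
  then have cR: "continuous_on (closure {0<..<T}) R" using T by simp
  have "R s = R (T / 2)" if s: "s \<in> {0<..<T}" for s
  proof -
    have R: "R x = R y" if "0 < x" "x < y" "y < T" for x y
    proof -
      have "integral {0..x} v + integral {x..y} v = integral {0..y} v"
        using that by (intro Henstock_Kurzweil_Integration.integral_combine L2_integrable_on[OF vL]) auto
      with weak_deriv_increment[OF wd U ae that] show ?thesis by (simp add: R_def)
    qed
    show ?thesis
    proof (cases s "T / 2" rule: linorder_cases)
      case less
      then show ?thesis by (rule R[rotated]) (use s T in auto)
    next
      case greater
      then show ?thesis by (intro R[symmetric]) (use s T in auto)
    qed (simp only:)
  qed
  note const = continuous_constant_on_closure[OF cR this]
  have "R t = R (T / 2)" by (rule const) (use t T in auto)
  moreover have "R 0 = R (T / 2)" by (rule const) (use T in auto)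
  ultimately show ?thesis by (simp add: R_def)
qed

text \<open>Replaces the weak formulation by identities valid at every t, for the continuous
  representatives of u and of its derivative. The initial conditions make both integration constants
  zero.\<close>

lemma U_space_integral_equations:
  assumes u: "u \<in> U_space T" and f: "f \<in> L2_space {0<..<T}" and "0 < T" "0 < c"
    and eq: "AE t in lebesgue_on {0<..<T}. 1 / c\<^sup>2 * weak_deriv T (weak_deriv T u) t + lamk * u t = f t"
  obtains U V where "continuous_on {0..T} U" "continuous_on {0..T} V"
    "AE t in lebesgue_on {0<..<T}. u t = U t"
    "AE t in lebesgue_on {0<..<T}. weak_deriv T (weak_deriv T u) t = c\<^sup>2 * (f t - lamk * u t)"
    "u \<in> L2_space {0<..<T}" "weak_deriv T (weak_deriv T u) \<in> L2_space {0<..<T}"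
    "\<And>t. t \<in> {0..T} \<Longrightarrow> U t = integral {0..t} V"
    "\<And>t. t \<in> {0..T} \<Longrightarrow> V t = integral {0..t} (\<lambda>s. c\<^sup>2 * f s) - c\<^sup>2 * lamk * integral {0..t} U"
proof -
  define v1 v2 where "v1 = weak_deriv T u" and "v2 = weak_deriv T v1"
  have ex: "\<exists>v. has_weak_deriv T u v" "\<exists>v. has_weak_deriv T v1 v"
    using u by (auto simp: U_space_def H2_def H1_def v1_def)
  \<comment> \<open>Membership in \<open>H2\<close> provides the existence that turns the choice in
    \<open>weak_deriv\<close> into an actual weak derivative.\<close>
  have wd1: "has_weak_deriv T u v1"
    unfolding v1_def weak_deriv_def by (rule someI_ex[OF ex(1)])
  have wd2: "has_weak_deriv T v1 v2"
    unfolding v2_def weak_deriv_def by (rule someI_ex[OF ex(2)])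
  obtain U where U: "continuous_on {0..T} U" "AE t in lebesgue_on {0<..<T}. u t = U t" "U 0 = 0"
    using u by (auto simp: U_space_def has_initial_value_def)
  obtain V where V: "continuous_on {0..T} V" "AE t in lebesgue_on {0<..<T}. v1 t = V t" "V 0 = 0"
    using u by (auto simp: U_space_def has_initial_value_def v1_def)
  have ae: "AE t in lebesgue_on {0<..<T}. v2 t = c\<^sup>2 * (f t - lamk * u t)"
    using eq unfolding v1_def[symmetric] v2_def[symmetric]
    by eventually_elim (use \<open>0 < c\<close> in \<open>auto simp: field_simps\<close>)
  have ae': "AE t in lebesgue_on {0<..<T}. v2 t = c\<^sup>2 * f t - c\<^sup>2 * lamk * U t"
    using ae U(2) by eventually_elim (simp add: algebra_simps)
  show ?thesis
  proof (rule that[OF U(1) V(1) U(2) ae[unfolded v2_def v1_def]])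
    show "u \<in> L2_space {0<..<T}" "weak_deriv T (weak_deriv T u) \<in> L2_space {0<..<T}"
      using wd1 wd2 by (auto simp: has_weak_deriv_def v1_def v2_def)
    fix t assume t: "t \<in> {0..T}"
    show "U t = integral {0..t} V"
      using weak_deriv_integral[OF wd1 U(1,2) \<open>0 < T\<close> t] AE_eq_imp_integral_eq[OF V(2) t] U(3) by simp
    have "V t = integral {0..t} (\<lambda>s. c\<^sup>2 * f s - c\<^sup>2 * lamk * U s)"
      using weak_deriv_integral[OF wd2 V(1,2) \<open>0 < T\<close> t] AE_eq_imp_integral_eq[OF ae' t] V(3) by simp
    also have "\<dots> = integral {0..t} (\<lambda>s. c\<^sup>2 * f s) - integral {0..t} (\<lambda>s. c\<^sup>2 * lamk * U s)"
      using t
      by (intro Henstock_Kurzweil_Integration.integral_diff integrable_on_mult_right L2_integrable_on[OF f]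
          integrable_continuous_real continuous_intros continuous_on_subset[OF U(1)]) auto
    finally show "V t = integral {0..t} (\<lambda>s. c\<^sup>2 * f s) - c\<^sup>2 * lamk * integral {0..t} U" by simp
  qed
qed

section \<open>Completeness of the cosine system\<close>

text \<open>Multiplied by T, the sum of the frequencies is (j + l + 1) pi, never zero, and their
  difference is (j - l) pi, zero only on the diagonal.\<close>

lemma integral_cos_freq_cos_freq:
  assumes "0 < T"
  shows "integral {0..T} (\<lambda>t. cos (freq T j * t) * cos (freq T l * t)) = (if j = l then T / 2 else 0)"
proof -
  have "(freq T j + freq T l) * T = real (j + l + 1) * pi"
    using assms by (simp add: freq_def field_simps)
  then have plus: "sinc ((freq T j + freq T l) * T) = 0"
    by (simp only: sin_npi) simp
  have eq: "(freq T j - freq T l) * T = (real j - real l) * pi"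
    using assms by (simp add: freq_def field_simps)
  have "sin ((real j - real l) * pi) = 0"
    by (simp add: sin_integer_2pi sin_times_pi_eq_0)
  then have minus: "sinc ((freq T j - freq T l) * T) = (if j = l then 1 else 0)"
    by (simp only: eq) simp
  have "integral {0..T} (\<lambda>t. cos (freq T j * t) * cos (freq T l * t))
      = T / 2 * (sinc ((freq T j + freq T l) * T) + sinc ((freq T j - freq T l) * T))"
    using assms by (intro integral_cos_cos) simp
  also have "\<dots> = (if j = l then T / 2 else 0)"
    by (simp only: plus minus) simp
  finally show ?thesis .
qed

section \<open>Cosine polynomials and uniform approximation\<close>

text \<open>Asking for the identity at every length M \<ge> N makes the coefficients vanish beyond
  N. Two such functions can then be written with equal length, and one can be compared with Fourier
  sums of every large length.\<close>

definition cos_poly :: "real \<Rightarrow> (real \<Rightarrow> real) \<Rightarrow> bool" where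
  "cos_poly T p \<longleftrightarrow> (\<exists>a N. \<forall>M\<ge>N. \<forall>t. p t = (\<Sum>j<M. a j * cos (freq T j * t)))"

lemma cos_poly_add:
  assumes "cos_poly T p" "cos_poly T q"
  shows "cos_poly T (\<lambda>t. p t + q t)"
proof -
  obtain a N b N' where a: "\<And>M t. M \<ge> N \<Longrightarrow> p t = (\<Sum>j<M. a j * cos (freq T j * t))"
    and b: "\<And>M t. M \<ge> N' \<Longrightarrow> q t = (\<Sum>j<M. b j * cos (freq T j * t))"
    using assms unfolding cos_poly_def by blast
  have "p t + q t = (\<Sum>j<M. (a j + b j) * cos (freq T j * t))" if "M \<ge> max N N'" for M t
    using that by (simp add: a[of M t] b[of M t] distrib_right sum.distrib)
  then have "\<forall>M\<ge>max N N'. \<forall>t. p t + q t = (\<Sum>j<M. (a j + b j) * cos (freq T j * t))"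
    by blast
  then show ?thesis unfolding cos_poly_def by (intro exI)
qed

lemma cos_poly_mult_left:
  assumes "cos_poly T p"
  shows "cos_poly T (\<lambda>t. r * p t)"
proof -
  obtain a N where a: "\<And>M t. M \<ge> N \<Longrightarrow> p t = (\<Sum>j<M. a j * cos (freq T j * t))"
    using assms unfolding cos_poly_def by blast
  have "r * p t = (\<Sum>j<M. (r * a j) * cos (freq T j * t))" if "M \<ge> N" for M t
    using that by (simp add: a[of M t] sum_distrib_left mult.assoc)
  then have "\<forall>M\<ge>N. \<forall>t. r * p t = (\<Sum>j<M. (r * a j) * cos (freq T j * t))"
    by blast
  then show ?thesis unfolding cos_poly_def by (intro exI)
qed

lemma cos_poly_sum:
  assumes "finite I" "\<And>i. i \<in> I \<Longrightarrow> cos_poly T (p i)"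
  shows "cos_poly T (\<lambda>t. \<Sum>i\<in>I. p i t)"
  using assms
proof (induction I)
  case empty
  have "\<forall>M\<ge>0. \<forall>t. (0::real) = (\<Sum>j<M. 0 * cos (freq T j * t))" by simp
  then show ?case unfolding cos_poly_def sum.empty by (intro exI)
next
  case (insert i I)
  then show ?case using cos_poly_add[of T "p i"] by simp
qed

lemma cos_poly_cos_freq: "cos_poly T (\<lambda>t. cos (freq T i * t))"
proof -
  have "\<forall>M\<ge>Suc i. \<forall>t. cos (freq T i * t) = (\<Sum>j<M. (if j = i then 1 else 0) * cos (freq T j * t))"
    by (simp add: if_distrib[of "\<lambda>x. x * _"] sum.delta cong: if_cong)
  then show ?thesis unfolding cos_poly_def by (intro exI)
qed

lemma cos_poly_mult_cos:
  assumes "0 < T" "cos_poly T p"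
  shows "cos_poly T (\<lambda>t. cos (pi * t / T) * p t)"
proof -
  obtain a N where p: "\<And>t. p t = (\<Sum>j<N. a j * cos (freq T j * t))"
    using assms(2) unfolding cos_poly_def by blast
  have basis: "cos_poly T (\<lambda>t. cos (pi * t / T) * cos (freq T j * t))" for j
  proof -
    \<comment> \<open>The product-to-sum formula shifts the index by one up and down. At j = 0 the
      downward shift is reflected: pi / T - \<omega>_0 is again \<omega>_0.\<close>
    define i where "i = (if j = 0 then 0 else j - 1)"
    have plus: "pi * t / T + freq T j * t = freq T (Suc j) * t" for t
      using assms(1) by (simp add: freq_def field_simps)
    have "pi * t / T - freq T j * t = freq T i * t \<or> pi * t / T - freq T j * t = - (freq T i * t)" for t
      using assms(1) by (cases j) (auto simp: i_def freq_def field_simps)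
    then have minus: "cos (pi * t / T - freq T j * t) = cos (freq T i * t)" for t
      by (metis cos_minus)
    have "cos (pi * t / T) * cos (freq T j * t)
        = 1 / 2 * cos (freq T i * t) + 1 / 2 * cos (freq T (Suc j) * t)" for t
      using cos_times_cos[of "pi * t / T" "freq T j * t"] by (simp only: plus minus) (simp add: field_simps)
    then show ?thesis
      by (simp only:) (intro cos_poly_add cos_poly_mult_left cos_poly_cos_freq)
  qed
  have "cos (pi * t / T) * p t = (\<Sum>j<N. a j * (cos (pi * t / T) * cos (freq T j * t)))" for t
    by (simp add: p sum_distrib_left mult_ac)
  then show ?thesis
    by (simp only:) (intro cos_poly_sum cos_poly_mult_left basis finite_lessThan)
qed

text \<open>The functions \<open>cos (freq T j t)\<close> span \<open>cos (\<pi> t / (2 T))\<close> times the polynomials in \<open>cos (\<pi> t / T)\<close>.\<close>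

lemma cos_poly_uniform_approximation:
  assumes T: "0 < T" and q: "continuous_on {0..T} q" and e: "0 < e"
  obtains p where "cos_poly T p" "\<And>t. t \<in> {0..T} \<Longrightarrow> \<bar>cos (freq T 0 * t) * q t - p t\<bar> \<le> e"
proof -
  \<comment> \<open>The substitution y = cos(pi t / T) maps [0, T] bijectively onto [-1, 1], which
    makes the polynomial Weierstrass theorem applicable.\<close>
  have "continuous_on {-1..1} (\<lambda>y. q (T / pi * arccos y))"
  proof (rule continuous_on_compose2[OF q])
    show "continuous_on {-1..1} (\<lambda>y. T / pi * arccos y)"
      by (intro continuous_intros) auto
    show "(\<lambda>y. T / pi * arccos y) ` {-1..1} \<subseteq> {0..T}"
      using T arccos_lbound arccos_ubound by (auto simp: field_simps intro!: mult_left_mono)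
  qed
  then obtain g where g: "real_polynomial_function g"
    "\<And>y. y \<in> {-1..1} \<Longrightarrow> \<bar>q (T / pi * arccos y) - g y\<bar> < e"
    using Stone_Weierstrass_real_polynomial_function[of "{-1..1::real}" _ e] e by (metis compact_Icc)
  then obtain b n where gb: "g = (\<lambda>x. \<Sum>i\<le>n. b i * x ^ i)"
    using real_polynomial_function_imp_sum by blast
  have pow: "cos_poly T (\<lambda>t. cos (pi * t / T) ^ i * cos (freq T 0 * t))" for i
  proof (induction i)
    case 0
    show ?case using cos_poly_cos_freq by simp
  next
    case (Suc i)
    from cos_poly_mult_cos[OF T this] show ?case by (simp add: mult.assoc)
  qed
  show ?thesis
  proof (rule that)
    have "cos_poly T (\<lambda>t. \<Sum>i\<le>n. b i * (cos (pi * t / T) ^ i * cos (freq T 0 * t)))"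
      by (intro cos_poly_sum cos_poly_mult_left pow finite_atMost)
    then show "cos_poly T (\<lambda>t. cos (freq T 0 * t) * g (cos (pi * t / T)))"
      by (simp add: gb sum_distrib_left mult_ac)
    fix t assume t: "t \<in> {0..T}"
    then have "0 \<le> pi * t / T" "pi * t / T \<le> pi" using T by (auto simp: field_simps)
    then have "T / pi * arccos (cos (pi * t / T)) = t" using T by (simp add: arccos_cos)
    then have "\<bar>q t - g (cos (pi * t / T))\<bar> < e"
      using g(2)[of "cos (pi * t / T)"] by simp
    then have "\<bar>cos (freq T 0 * t)\<bar> * \<bar>q t - g (cos (pi * t / T))\<bar> \<le> 1 * e"
      by (intro mult_mono) auto
    then show "\<bar>cos (freq T 0 * t) * q t - cos (freq T 0 * t) * g (cos (pi * t / T))\<bar> \<le> e"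
      by (simp add: right_diff_distrib[symmetric] abs_mult)
  qed
qed

section \<open>Density in L2\<close>

lemma LINT_square_sum3_le:
  fixes f g h :: "'a::euclidean_space \<Rightarrow> real"
  assumes f: "f \<in> L2_space S" and g: "g \<in> L2_space S" and h: "h \<in> L2_space S"
  shows "(LINT x|lebesgue_on S. (f x + g x + h x)\<^sup>2) \<le>
    3 * ((LINT x|lebesgue_on S. (f x)\<^sup>2) + (LINT x|lebesgue_on S. (g x)\<^sup>2) + (LINT x|lebesgue_on S. (h x)\<^sup>2))"
proof -
  note i = integrable_power2_L2[OF f] integrable_power2_L2[OF g] integrable_power2_L2[OF h]
  have "(\<lambda>x. f x + g x + h x) \<in> L2_space S"
    using L2_space_lincomb[OF L2_space_lincomb[OF f g, of 1 1] h, of 1 1] by simp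
  then have "(LINT x|lebesgue_on S. (f x + g x + h x)\<^sup>2)
      \<le> (LINT x|lebesgue_on S. 3 * ((f x)\<^sup>2 + (g x)\<^sup>2 + (h x)\<^sup>2))"
  proof (intro integral_mono)
    show "integrable (lebesgue_on S) (\<lambda>x. 3 * ((f x)\<^sup>2 + (g x)\<^sup>2 + (h x)\<^sup>2))"
      by (intro integrable_mult_right Bochner_Integration.integrable_add i)
    fix x
    have "0 \<le> (f x - g x)\<^sup>2 + (g x - h x)\<^sup>2 + (f x - h x)\<^sup>2" by simp
    then show "(f x + g x + h x)\<^sup>2 \<le> 3 * ((f x)\<^sup>2 + (g x)\<^sup>2 + (h x)\<^sup>2)"
      by (simp add: power2_eq_square algebra_simps)
  qed (auto intro: integrable_power2_L2)
  also have "\<dots> = 3 * ((LINT x|lebesgue_on S. (f x)\<^sup>2) + (LINT x|lebesgue_on S. (g x)\<^sup>2) + (LINT x|lebesgue_on S. (h x)\<^sup>2))"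
    using i by simp
  finally show ?thesis .
qed

definition clamp_real :: "real \<Rightarrow> real \<Rightarrow> real" where
  "clamp_real m x = max (- m) (min m x)"

lemma clamp_real_bounds: "0 \<le> m \<Longrightarrow> \<bar>clamp_real m x\<bar> \<le> m"
  by (auto simp: clamp_real_def)

lemma clamp_real_eq: "\<bar>x\<bar> \<le> m \<Longrightarrow> clamp_real m x = x"
  by (auto simp: clamp_real_def)

lemma abs_diff_clamp_real_le: "0 \<le> m \<Longrightarrow> \<bar>x - clamp_real m x\<bar> \<le> \<bar>x\<bar>"
  by (auto simp: clamp_real_def max_def min_def)

lemma continuous_on_clamp_real [continuous_intros]:
  "continuous_on S f \<Longrightarrow> continuous_on S (\<lambda>x. clamp_real m (f x))"
  unfolding clamp_real_def by (intro continuous_intros)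

lemma measurable_clamp_real [measurable]:
  "f \<in> borel_measurable M \<Longrightarrow> (\<lambda>x. clamp_real m (f x)) \<in> borel_measurable M"
  unfolding clamp_real_def by (intro borel_measurable_max borel_measurable_min borel_measurable_const)

text \<open>Dominated by the square of f, since the truncation error never exceeds |f|. It reduces
  density to bounded functions, for which pointwise approximation suffices.\<close>

lemma truncation_tendsto_L2:
  fixes f :: "'a::euclidean_space \<Rightarrow> real"
  assumes f: "f \<in> L2_space S"
  shows "(\<lambda>n. LINT x|lebesgue_on S. (f x - clamp_real (real n) (f x))\<^sup>2) \<longlonglongrightarrow> 0"
proof -
  note [measurable] = L2_spaceD(1)[OF f]
  have "(\<lambda>n. LINT x|lebesgue_on S. (f x - clamp_real (real n) (f x))\<^sup>2) \<longlonglongrightarrow> (LINT x|lebesgue_on S. 0)"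
  proof (rule integral_dominated_convergence)
    show "integrable (lebesgue_on S) (\<lambda>x. (f x)\<^sup>2)" by (rule integrable_power2_L2[OF f])
    show "AE x in lebesgue_on S. norm ((f x - clamp_real (real n) (f x))\<^sup>2) \<le> (f x)\<^sup>2" for n
      using abs_diff_clamp_real_le[of "real n"] by (auto simp: abs_le_square_iff[symmetric])
    show "AE x in lebesgue_on S. (\<lambda>n. (f x - clamp_real (real n) (f x))\<^sup>2) \<longlonglongrightarrow> 0"
    proof (rule AE_I2)
      fix x
      have "\<forall>\<^sub>F n in sequentially. \<bar>f x\<bar> \<le> real n"
        using filterlim_real_sequentially by (auto simp: filterlim_at_top)
      then have "\<forall>\<^sub>F n in sequentially. (f x - clamp_real (real n) (f x))\<^sup>2 = 0"
        by eventually_elim (simp add: clamp_real_eq)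
      then show "(\<lambda>n. (f x - clamp_real (real n) (f x))\<^sup>2) \<longlonglongrightarrow> 0" by (rule tendsto_eventually)
    qed
  qed (measurable)
  then show ?thesis by simp
qed

text \<open>Multiplying by \<open>C\<^sup>2 / (C\<^sup>2 + \<epsilon>)\<close> makes an approximant divisible by \<open>C = cos (\<pi> t / (2 T))\<close>, which
  vanishes at \<open>T\<close>.\<close>

lemma bounded_approximation_L2:
  fixes h :: "real \<Rightarrow> real"
  assumes T: "0 < T" and h: "h \<in> borel_measurable (lebesgue_on {0<..<T})"
    and m: "0 \<le> m" "\<And>x. \<bar>h x\<bar> \<le> m"
  obtains q where "\<And>n. continuous_on {0..T} (q n)"
    "(\<lambda>n. LINT t|lebesgue_on {0<..<T}. (h t - cos (freq T 0 * t) * q n t)\<^sup>2) \<longlonglongrightarrow> 0"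
proof -
  \<comment> \<open>This notion of measurability supplies continuous g_n that converge to h off a
    null set; clamping them at m provides the dominating constant (2 m)^2.\<close>
  have "h measurable_on {0<..<T}"
    using h by (simp add: measurable_on_iff_borel_measurable)
  then obtain N g where N: "negligible N" and g: "\<And>n. continuous_on UNIV (g n)"
    "\<And>x. x \<notin> N \<Longrightarrow> (\<lambda>n. g n x) \<longlonglongrightarrow> (if x \<in> {0<..<T} then h x else 0)"
    unfolding measurable_on_def by blast
  define C where "C t = cos (freq T 0 * t)" for t
  define q where "q n t = clamp_real m (g n t) * C t / ((C t)\<^sup>2 + 1 / real (Suc n))" for n t
  have pos: "0 < (C t)\<^sup>2 + 1 / real (Suc n)" for n t by (simp add: add_nonneg_pos)
  have cq: "continuous_on {0..T} (q n)" for n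
    unfolding q_def
  proof (intro continuous_intros ballI)
    show "continuous_on {0..T} (g n)" using g(1) by (rule continuous_on_subset) simp
    show "continuous_on {0..T} C" "continuous_on {0..T} C"
      unfolding C_def by (intro continuous_intros)+
    show "(C t)\<^sup>2 + 1 / real (Suc n) \<noteq> 0" for t using pos[of t n] by simp
  qed
  have cC: "continuous_on {0..T} (\<lambda>t. C t * q n t)" for n
    unfolding C_def by (intro continuous_intros cq)
  have qm: "(\<lambda>t. C t * q n t) \<in> borel_measurable (lebesgue_on {0<..<T})" for n
    by (rule borel_measurable_integrable[OF integrable_lebesgue_on_continuous[OF cC]])
  have Cq: "C t * q n t = clamp_real m (g n t) * ((C t)\<^sup>2 / ((C t)\<^sup>2 + 1 / real (Suc n)))" for n t
    by (simp add: q_def power2_eq_square)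
  have qb: "\<bar>C t * q n t\<bar> \<le> m" for n t
  proof -
    have "\<bar>clamp_real m (g n t)\<bar> * \<bar>(C t)\<^sup>2 / ((C t)\<^sup>2 + 1 / real (Suc n))\<bar> \<le> m * 1"
      using clamp_real_bounds[OF m(1)] m(1) pos[of t n] by (intro mult_mono) auto
    then show ?thesis by (simp add: Cq abs_mult)
  qed
  have Cpos: "0 < C t" if "t \<in> {0<..<T}" for t
    unfolding C_def using that T by (intro cos_gt_zero) (auto simp: freq_def field_simps)
  have "(\<lambda>n. LINT t|lebesgue_on {0<..<T}. (h t - C t * q n t)\<^sup>2) \<longlonglongrightarrow> (LINT t|lebesgue_on {0<..<T}. 0)"
  proof (rule integral_dominated_convergence)
    show "integrable (lebesgue_on {0<..<T}) (\<lambda>_. (2 * m)\<^sup>2)"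
      by (rule integrable_lebesgue_on_continuous) simp
    show "(\<lambda>t. (h t - C t * q n t)\<^sup>2) \<in> borel_measurable (lebesgue_on {0<..<T})" for n
      using h qm[of n] by measurable
    show "AE t in lebesgue_on {0<..<T}. norm ((h t - C t * q n t)\<^sup>2) \<le> (2 * m)\<^sup>2" for n
    proof (rule AE_I2)
      fix t
      have "\<bar>h t - C t * q n t\<bar> \<le> \<bar>2 * m\<bar>"
        using m(2)[of t] qb[of t n] by linarith
      then show "norm ((h t - C t * q n t)\<^sup>2) \<le> (2 * m)\<^sup>2" by (simp add: abs_le_square_iff)
    qed
    have "(\<lambda>n. (h t - C t * q n t)\<^sup>2) \<longlonglongrightarrow> 0" if t: "t \<in> {0<..<T}" "t \<notin> N" for t
    proof -
      have "(\<lambda>n. g n t) \<longlonglongrightarrow> h t" using g(2)[OF t(2)] t(1) by simp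
      then have "(\<lambda>n. clamp_real m (g n t)) \<longlonglongrightarrow> clamp_real m (h t)"
        unfolding clamp_real_def by (intro tendsto_intros)
      then have "(\<lambda>n. clamp_real m (g n t)) \<longlonglongrightarrow> h t" using m(2) by (simp add: clamp_real_eq)
      moreover have "(\<lambda>n. (C t)\<^sup>2 / ((C t)\<^sup>2 + 1 / real (Suc n))) \<longlonglongrightarrow> (C t)\<^sup>2 / ((C t)\<^sup>2 + 0)"
        using Cpos[OF t(1)] by (intro tendsto_intros LIMSEQ_Suc[OF lim_1_over_n]) auto
      ultimately have "(\<lambda>n. (h t - C t * q n t)\<^sup>2) \<longlonglongrightarrow> (h t - h t * ((C t)\<^sup>2 / ((C t)\<^sup>2 + 0)))\<^sup>2"
        unfolding Cq by (intro tendsto_power tendsto_diff tendsto_const tendsto_mult)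
      then show ?thesis using Cpos[OF t(1)] by simp
    qed
    moreover have "AE t in lebesgue. t \<notin> N"
      using N unfolding eventually_ae_filter_negligible by auto
    ultimately show "AE t in lebesgue_on {0<..<T}. (\<lambda>n. (h t - C t * q n t)\<^sup>2) \<longlonglongrightarrow> 0"
      by (simp add: AE_restrict_space_iff) (auto elim: eventually_mono)
  qed simp
  with cq show ?thesis by (intro that) (simp_all add: C_def)
qed

lemma cos_poly_continuous:
  assumes "cos_poly T p"
  shows "continuous_on S p"
proof -
  obtain a N where p: "p = (\<lambda>t. \<Sum>j<N. a j * cos (freq T j * t))"
    using assms unfolding cos_poly_def by blast
  show ?thesis unfolding p by (intro continuous_intros)
qed

lemma cos_poly_dense_L2:
  assumes T: "0 < T" and f: "f \<in> L2_space {0<..<T}" and e: "0 < e"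
  obtains p where "cos_poly T p" "(LINT t|lebesgue_on {0<..<T}. (f t - p t)\<^sup>2) < e"
proof -
  \<comment> \<open>Three approximation errors below e / 9 each, and the factor 3 from
    \<open>LINT_square_sum3_le\<close>, add up to less than e.\<close>
  have e9: "0 < e / 9" using e by simp
  from order_tendstoD(2)[OF truncation_tendsto_L2[OF f] e9]
  obtain n where n: "(LINT t|lebesgue_on {0<..<T}. (f t - clamp_real (real n) (f t))\<^sup>2) < e / 9"
    by (meson eventually_sequentially order_refl)
  define h where "h t = clamp_real (real n) (f t)" for t
  have hm: "h \<in> borel_measurable (lebesgue_on {0<..<T})"
    unfolding h_def using L2_spaceD(1)[OF f] by measurable
  have hb: "\<bar>h t\<bar> \<le> real n" for t unfolding h_def by (rule clamp_real_bounds) simp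
  have hL: "h \<in> L2_space {0<..<T}"
  proof -
    have "integrable (lebesgue_on {0<..<T}) (\<lambda>t. (h t)\<^sup>2)"
    proof (rule Bochner_Integration.integrable_bound)
      show "integrable (lebesgue_on {0<..<T}) (\<lambda>_. (real n)\<^sup>2)"
        by (rule integrable_lebesgue_on_continuous) simp
      show "(\<lambda>t. (h t)\<^sup>2) \<in> borel_measurable (lebesgue_on {0<..<T})" using hm by measurable
      show "AE t in lebesgue_on {0<..<T}. norm ((h t)\<^sup>2) \<le> norm ((real n)\<^sup>2)"
        using hb by (auto simp: abs_le_square_iff[symmetric])
    qed
    with hm show ?thesis by (simp add: L2_space_def)
  qed
  obtain q where q: "\<And>n. continuous_on {0..T} (q n)"
    "(\<lambda>n. LINT t|lebesgue_on {0<..<T}. (h t - cos (freq T 0 * t) * q n t)\<^sup>2) \<longlonglongrightarrow> 0"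
    using bounded_approximation_L2[OF T hm _ hb] by auto
  from order_tendstoD(2)[OF q(2) e9]
  obtain k where k: "(LINT t|lebesgue_on {0<..<T}. (h t - cos (freq T 0 * t) * q k t)\<^sup>2) < e / 9"
    by (meson eventually_sequentially order_refl)
  \<comment> \<open>A uniform error of this size costs e / 10 in squared L2 norm on an interval of
    length T, strictly below e / 9.\<close>
  have "0 < sqrt (e / (10 * T))" using e T by simp
  then obtain p where p: "cos_poly T p"
    "\<And>t. t \<in> {0..T} \<Longrightarrow> \<bar>cos (freq T 0 * t) * q k t - p t\<bar> \<le> sqrt (e / (10 * T))"
    using cos_poly_uniform_approximation[OF T q(1)] by metis
  define r where "r t = cos (freq T 0 * t) * q k t" for t
  have cr: "continuous_on {0..T} r" unfolding r_def by (intro continuous_intros q)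
  have cp: "continuous_on {0..T} p" by (rule cos_poly_continuous[OF p(1)])
  have "(LINT t|lebesgue_on {0<..<T}. (r t - p t)\<^sup>2) \<le> (LINT t|lebesgue_on {0<..<T}. e / (10 * T))"
  proof (rule integral_mono)
    fix t assume "t \<in> space (lebesgue_on {0<..<T})"
    then have "\<bar>r t - p t\<bar> \<le> sqrt (e / (10 * T))" using p(2)[of t] by (simp add: r_def)
    then have "\<bar>r t - p t\<bar>\<^sup>2 \<le> (sqrt (e / (10 * T)))\<^sup>2" by (intro power_mono) auto
    then show "(r t - p t)\<^sup>2 \<le> e / (10 * T)" using e T by simp
  qed (intro integrable_lebesgue_on_continuous continuous_intros cr cp)+
  also have "\<dots> = e / 10" using T by (subst LINT_lebesgue_on_continuous) auto
  also have "\<dots> < e / 9" using e by simp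
  finally have rp: "(LINT t|lebesgue_on {0<..<T}. (r t - p t)\<^sup>2) < e / 9" .
  note L = continuous_in_L2_space[OF cr] continuous_in_L2_space[OF cp]
  have "(LINT t|lebesgue_on {0<..<T}. (f t - p t)\<^sup>2)
      = (LINT t|lebesgue_on {0<..<T}. ((f t - h t) + (h t - r t) + (r t - p t))\<^sup>2)" by simp
  also have "\<dots> \<le> 3 * ((LINT t|lebesgue_on {0<..<T}. (f t - h t)\<^sup>2)
      + (LINT t|lebesgue_on {0<..<T}. (h t - r t)\<^sup>2) + (LINT t|lebesgue_on {0<..<T}. (r t - p t)\<^sup>2))"
    by (intro LINT_square_sum3_le L2_space_diff f hL L)
  also have "\<dots> < e" using n k rp unfolding h_def r_def by simp
  finally show ?thesis using p(1) that by blast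
qed

section \<open>Fourier partial sums and best approximation\<close>

definition fourier_sum :: "real \<Rightarrow> (real \<Rightarrow> real) \<Rightarrow> nat \<Rightarrow> real \<Rightarrow> real" where
  "fourier_sum T f N t = (\<Sum>j<N. fourier_coeff T f j * cos (freq T j * t))"

text \<open>Completing the square in the coefficients. The last term vanishes at the Fourier
  coefficients, which gives Bessel's inequality and optimality of the Fourier sum together.\<close>

lemma LINT_diff_cos_sum_square:
  assumes T: "0 < T" and f: "f \<in> L2_space {0<..<T}"
  shows "(LINT t|lebesgue_on {0<..<T}. (f t - (\<Sum>j<N. a j * cos (freq T j * t)))\<^sup>2)
    = (LINT t|lebesgue_on {0<..<T}. (f t)\<^sup>2) - T / 2 * (\<Sum>j<N. (fourier_coeff T f j)\<^sup>2)
      + T / 2 * (\<Sum>j<N. (a j - fourier_coeff T f j)\<^sup>2)"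
proof -
  define M where "M = lebesgue_on {0<..<T}"
  define e where "e j t = cos (freq T j * t)" for j t
  have ce: "continuous_on {0..T} (e j)" for j unfolding e_def by (intro continuous_intros)
  have i1: "integrable M (\<lambda>t. f t * e j t)" for j
    unfolding M_def by (intro integrable_mult_L2 f continuous_in_L2_space ce)
  have i2: "integrable M (\<lambda>t. e j t * e l t)" for j l
    unfolding M_def by (intro integrable_mult_L2 continuous_in_L2_space ce)
  have i0: "integrable M (\<lambda>t. (f t)\<^sup>2)"
    unfolding M_def by (rule integrable_power2_L2[OF f])
  have c1: "(LINT t|M. f t * e j t) = T / 2 * fourier_coeff T f j" for j
    using T by (simp add: fourier_coeff_def M_def e_def)
  have c2: "(LINT t|M. e j t * e l t) = (if j = l then T / 2 else 0)" for j l
  proof -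
    have "(LINT t|M. e j t * e l t) = integral {0..T} (\<lambda>t. e j t * e l t)"
      unfolding M_def by (intro LINT_lebesgue_on_continuous continuous_intros ce)
    then show ?thesis using integral_cos_freq_cos_freq[OF T] by (simp add: e_def)
  qed
  have "(f t - (\<Sum>j<N. a j * e j t))\<^sup>2 = (f t)\<^sup>2 - 2 * (\<Sum>j<N. a j * (f t * e j t))
      + (\<Sum>j<N. \<Sum>l<N. a j * a l * (e j t * e l t))" for t
  proof -
    have "(\<Sum>j<N. a j * e j t)\<^sup>2 = (\<Sum>j<N. \<Sum>l<N. a j * a l * (e j t * e l t))"
      by (simp add: power2_eq_square sum_product mult_ac)
    moreover have "f t * (\<Sum>j<N. a j * e j t) = (\<Sum>j<N. a j * (f t * e j t))"
      by (simp add: sum_distrib_left mult_ac)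
    ultimately show ?thesis by (simp add: power2_diff mult.assoc)
  qed
  then have "(LINT t|M. (f t - (\<Sum>j<N. a j * e j t))\<^sup>2) = (LINT t|M. (f t)\<^sup>2 - 2 * (\<Sum>j<N. a j * (f t * e j t))
      + (\<Sum>j<N. \<Sum>l<N. a j * a l * (e j t * e l t)))" by (simp only:)
  also have "\<dots> = (LINT t|M. (f t)\<^sup>2) - 2 * (\<Sum>j<N. a j * (T / 2 * fourier_coeff T f j))
      + (\<Sum>j<N. \<Sum>l<N. a j * a l * (if j = l then T / 2 else 0))"
    using i0 i1 i2 by (simp add: c1 c2)
  also have "\<dots> = (LINT t|M. (f t)\<^sup>2) - T / 2 * (\<Sum>j<N. 2 * (a j * fourier_coeff T f j)) + T / 2 * (\<Sum>j<N. (a j)\<^sup>2)"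
    by (simp add: if_distrib[of "\<lambda>x. _ * x"] sum.delta sum_distrib_left power2_eq_square mult_ac cong: if_cong)
  also have "\<dots> = (LINT t|M. (f t)\<^sup>2) - T / 2 * (\<Sum>j<N. (fourier_coeff T f j)\<^sup>2)
      + T / 2 * (\<Sum>j<N. (a j - fourier_coeff T f j)\<^sup>2)"
    by (simp add: power2_diff sum.distrib sum_subtractf algebra_simps)
  finally show ?thesis by (simp only: M_def e_def)
qed

lemma Bessel_inequality:
  assumes "0 < T" "f \<in> L2_space {0<..<T}"
  shows "T / 2 * (\<Sum>j<N. (fourier_coeff T f j)\<^sup>2) \<le> (LINT t|lebesgue_on {0<..<T}. (f t)\<^sup>2)"
proof -
  have "0 \<le> (LINT t|lebesgue_on {0<..<T}. (f t - (\<Sum>j<N. fourier_coeff T f j * cos (freq T j * t)))\<^sup>2)"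
    by simp
  then show ?thesis unfolding LINT_diff_cos_sum_square[OF assms] by simp
qed

text \<open>A dense cosine polynomial can be written with any M \<ge> N terms, and the Fourier sum
  of the same length is at least as close to f.\<close>

lemma fourier_sum_tendsto_L2:
  assumes T: "0 < T" and f: "f \<in> L2_space {0<..<T}"
  shows "(\<lambda>N. LINT t|lebesgue_on {0<..<T}. (f t - fourier_sum T f N t)\<^sup>2) \<longlonglongrightarrow> 0"
proof (rule LIMSEQ_I)
  fix e :: real assume e: "0 < e"
  obtain p where p: "cos_poly T p" "(LINT t|lebesgue_on {0<..<T}. (f t - p t)\<^sup>2) < e"
    using cos_poly_dense_L2[OF T f e] by blast
  then obtain a N where a: "\<And>M t. M \<ge> N \<Longrightarrow> p t = (\<Sum>j<M. a j * cos (freq T j * t))"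
    unfolding cos_poly_def by blast
  have "(LINT t|lebesgue_on {0<..<T}. (f t - fourier_sum T f M t)\<^sup>2) < e" if "M \<ge> N" for M
  proof -
    have "(LINT t|lebesgue_on {0<..<T}. (f t - fourier_sum T f M t)\<^sup>2)
        \<le> (LINT t|lebesgue_on {0<..<T}. (f t - (\<Sum>j<M. a j * cos (freq T j * t)))\<^sup>2)"
      unfolding fourier_sum_def LINT_diff_cos_sum_square[OF T f] using T by (simp add: sum_nonneg)
    also have "\<dots> < e" using p(2) a[OF that] by simp
    finally show ?thesis .
  qed
  then show "\<exists>N. \<forall>M\<ge>N. norm ((LINT t|lebesgue_on {0<..<T}. (f t - fourier_sum T f M t)\<^sup>2) - 0) < e"
    by auto
qed

section \<open>Convergence of the double series\<close>

text \<open>The weight of the second derivative loses its c^4 to the factor c^2 in the equation,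
  matching \<open>mode_integrand\<close>.\<close>

lemma U_norm_power2:
  assumes "0 < c" "0 < lamk"
    and ae: "AE t in lebesgue_on {0<..<T}. weak_deriv T (weak_deriv T u) t = c\<^sup>2 * (f t - lamk * u t)"
    and "weak_deriv T (weak_deriv T u) \<in> L2_space {0<..<T}" "u \<in> L2_space {0<..<T}" "f \<in> L2_space {0<..<T}"
  shows "(U_norm T c lamk u)\<^sup>2 = lamk * (LINT t|lebesgue_on {0<..<T}. (u t)\<^sup>2)
    + 1 / lamk * (LINT t|lebesgue_on {0<..<T}. (f t - lamk * u t)\<^sup>2)"
proof -
  have L2: "(L2_norm {0<..<T} g)\<^sup>2 = (LINT t|lebesgue_on {0<..<T}. (g t)\<^sup>2)" for g :: "real \<Rightarrow> real"
    by (simp add: L2_norm_def)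
  have "(\<lambda>t. f t - lamk * u t) \<in> L2_space {0<..<T}"
    using L2_space_lincomb[OF assms(6,5), of 1 "- lamk"] by simp
  note meas = L2_spaceD(1)[OF this] L2_spaceD(1)[OF assms(4)]
  have "(LINT t|lebesgue_on {0<..<T}. (weak_deriv T (weak_deriv T u) t)\<^sup>2)
      = (LINT t|lebesgue_on {0<..<T}. c^4 * (f t - lamk * u t)\<^sup>2)"
  proof (rule Bochner_Integration.integral_cong_AE)
    show "AE t in lebesgue_on {0<..<T}. (weak_deriv T (weak_deriv T u) t)\<^sup>2 = c^4 * (f t - lamk * u t)\<^sup>2"
      using ae by eventually_elim (simp add: power_mult_distrib flip: power_mult)
  qed (intro borel_measurable_times borel_measurable_power borel_measurable_const meas)+
  then show ?thesis
    using assms(1,2) by (simp add: U_norm_def L2)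
qed

lemma LINT_square_le_of_bound:
  fixes g D :: "real \<Rightarrow> real"
  assumes T: "0 < T" and ae: "AE t in lebesgue_on {0<..<T}. g t = D t"
    and g: "g \<in> L2_space {0<..<T}" and b: "\<And>t. t \<in> {0..T} \<Longrightarrow> \<bar>D t\<bar> \<le> b"
  shows "(LINT t|lebesgue_on {0<..<T}. (g t)\<^sup>2) \<le> T * b\<^sup>2"
proof -
  have "AE t in lebesgue_on {0<..<T}. t \<in> {0<..<T}" by (auto intro: AE_I2)
  with ae have "AE t in lebesgue_on {0<..<T}. (g t)\<^sup>2 \<le> b\<^sup>2"
  proof eventually_elim
    case (elim t)
    then have "\<bar>g t\<bar> \<le> b" using b[of t] by simp
    then show ?case by (rule power2_le_iff_abs_le[THEN iffD2, rotated]) (use elim b[of t] in auto)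
  qed
  then have "(LINT t|lebesgue_on {0<..<T}. (g t)\<^sup>2) \<le> (LINT t|lebesgue_on {0<..<T}. b\<^sup>2)"
    by (intro integral_mono_AE[OF integrable_power2_L2[OF g] integrable_lebesgue_on_continuous]) auto
  also have "\<dots> = T * b\<^sup>2" using T by (subst LINT_lebesgue_on_continuous) auto
  finally show ?thesis .
qed

section \<open>Approximation of the solution by superposed modes\<close>

context
  fixes T c lamk a :: real and f u :: "real \<Rightarrow> real"
  assumes T: "0 < T" and c: "0 < c" and lamk: "0 < lamk"
    and f: "f \<in> L2_space {0<..<T}" and u: "u \<in> U_space T"
    and eq: "AE t in lebesgue_on {0<..<T}. 1 / c\<^sup>2 * weak_deriv T (weak_deriv T u) t + lamk * u t = f t"
  defines "a \<equiv> sqrt (mu c lamk)"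
begin

definition mode_sum :: "nat \<Rightarrow> real \<Rightarrow> real" where
  "mode_sum N t = (\<Sum>j<N. fourier_coeff T f j * wave_mode c a (freq T j) t)"

lemma continuous_on_mode_sum: "continuous_on S (mode_sum N)"
  unfolding mode_sum_def by (intro continuous_intros)

lemma continuous_on_fourier_sum: "continuous_on S (fourier_sum T f N)"
  unfolding fourier_sum_def by (intro continuous_intros)

text \<open>By linearity the difference solves the integrated oscillator equations with force c^2 (f
  - S_N), where S_N is the Fourier sum. Its primitive is bounded by c^2 times the L1 norm of f -
  S_N.\<close>

lemma mode_sum_error:
  assumes U: "continuous_on {0..T} U" "continuous_on {0..T} V"
    and UV: "\<And>t. t \<in> {0..T} \<Longrightarrow> U t = integral {0..t} V"
    "\<And>t. t \<in> {0..T} \<Longrightarrow> V t = integral {0..t} (\<lambda>s. c\<^sup>2 * f s) - c\<^sup>2 * lamk * integral {0..t} U"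
    and t: "t \<in> {0..T}"
  shows "\<bar>U t - mode_sum N t\<bar> \<le> 2 * T * (c\<^sup>2 * (LINT t|lebesgue_on {0<..<T}. \<bar>f t - fourier_sum T f N t\<bar>))"
proof -
  have a: "0 < a" "a\<^sup>2 = c\<^sup>2 * lamk" using c lamk by (auto simp: a_def mu_def)
  define w where "w j = wave_mode c a (freq T j)" for j
  define F where "F = fourier_coeff T f"
  have "\<exists>v. continuous_on UNIV v \<and> (\<forall>t\<ge>0. w j t = integral {0..t} v) \<and>
      (\<forall>t\<ge>0. v t = c\<^sup>2 * (sin (freq T j * t) / freq T j) - a\<^sup>2 * integral {0..t} (w j))" for j
    using wave_mode_integral_equations[OF a(1) freq_pos[OF T, of j], of c] unfolding w_def by metis
  then obtain v where v: "\<And>j. continuous_on UNIV (v j)" "\<And>j t. 0 \<le> t \<Longrightarrow> w j t = integral {0..t} (v j)"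
    "\<And>j t. 0 \<le> t \<Longrightarrow> v j t = c\<^sup>2 * (sin (freq T j * t) / freq T j) - a\<^sup>2 * integral {0..t} (w j)"
    by metis
  have cw: "continuous_on S (w j)" for S j unfolding w_def by (intro continuous_intros)
  have cv: "continuous_on S (v j)" for S j using v(1) by (rule continuous_on_subset) simp
  define D E G where "D t = U t - mode_sum N t" and "E t = V t - (\<Sum>j<N. F j * v j t)"
    and "G t = c\<^sup>2 * integral {0..t} (\<lambda>s. f s - fourier_sum T f N s)" for t
  have fL: "(\<lambda>s. f s - fourier_sum T f N s) \<in> L2_space {0<..<T}"
    by (intro L2_space_diff f continuous_in_L2_space continuous_on_fourier_sum)
  have "\<bar>D t\<bar> \<le> 2 * T * (c\<^sup>2 * (LINT t|lebesgue_on {0<..<T}. \<bar>f t - fourier_sum T f N t\<bar>))"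
  proof (rule oscillator_stability[where D = D and E = E and G = G and t = t and \<mu> = "a\<^sup>2" and T = T])
    show "continuous_on {0..T} D"
      unfolding D_def by (intro continuous_intros U continuous_on_mode_sum)
    show "continuous_on {0..T} G"
      unfolding G_def using L2_integrable_on[OF fL, of 0 T]
      by (intro continuous_intros indefinite_integral_continuous_1) auto
    fix t assume t: "t \<in> {0..T}"
    have sub: "continuous_on {0..t} U" "continuous_on {0..t} V"
      using U t by (auto intro: continuous_on_subset)
    show "\<bar>G t\<bar> \<le> c\<^sup>2 * (LINT t|lebesgue_on {0<..<T}. \<bar>f t - fourier_sum T f N t\<bar>)"
      using abs_integral_le_LINT[OF fL t] by (simp add: G_def abs_mult mult_left_mono)
    have intsum: "integral {0..t} (\<lambda>s. \<Sum>j<N. F j * g j s) = (\<Sum>j<N. F j * integral {0..t} (g j))"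
      if "\<And>j. continuous_on {0..t} (g j)" for g
      using that by (subst Henstock_Kurzweil_Integration.integral_sum)
        (auto intro!: integrable_continuous_real continuous_intros)
    have "integral {0..t} E = integral {0..t} V - integral {0..t} (\<lambda>s. \<Sum>j<N. F j * v j s)"
      unfolding E_def
      by (intro Henstock_Kurzweil_Integration.integral_diff integrable_continuous_real continuous_intros sub cv)
    also have "\<dots> = U t - (\<Sum>j<N. F j * w j t)"
      using UV(1)[OF t] v(2) t by (simp add: intsum[OF cv])
    finally show "D t = integral {0..t} E"
      by (simp add: D_def mode_sum_def w_def F_def)
    have "integral {0..t} D = integral {0..t} U - integral {0..t} (\<lambda>s. \<Sum>j<N. F j * w j s)"
      unfolding D_def mode_sum_def w_def[symmetric] F_def[symmetric]
      by (intro Henstock_Kurzweil_Integration.integral_diff integrable_continuous_real continuous_intros sub cw)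
    then have iD: "integral {0..t} D = integral {0..t} U - (\<Sum>j<N. F j * integral {0..t} (w j))"
      by (simp add: intsum[OF cw])
    have sin: "((\<lambda>t. sin (freq T j * t) / freq T j) has_real_derivative cos (freq T j * t)) (at t)" for j t
      using freq_pos[OF T, of j] by (auto intro!: derivative_eq_intros)
    have "integral {0..t} (\<lambda>s. f s - fourier_sum T f N s)
        = integral {0..t} f - integral {0..t} (\<lambda>s. \<Sum>j<N. F j * cos (freq T j * s))"
      unfolding fourier_sum_def F_def using t
      by (intro Henstock_Kurzweil_Integration.integral_diff L2_integrable_on[OF f]
          integrable_continuous_real continuous_intros) auto
    also have "integral {0..t} (\<lambda>s. \<Sum>j<N. F j * cos (freq T j * s))
        = (\<Sum>j<N. F j * integral {0..t} (\<lambda>s. cos (freq T j * s)))"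
      by (rule intsum) (intro continuous_intros)
    also have "\<dots> = (\<Sum>j<N. F j * (sin (freq T j * t) / freq T j))"
      using t integral_of_derivative[OF _ sin, of t] by simp
    finally have "G t = c\<^sup>2 * integral {0..t} f - (\<Sum>j<N. F j * (c\<^sup>2 * (sin (freq T j * t) / freq T j)))"
      by (simp add: G_def right_diff_distrib sum_distrib_left mult_ac)
    moreover have "E t = c\<^sup>2 * integral {0..t} f - a\<^sup>2 * integral {0..t} U
        - (\<Sum>j<N. F j * (c\<^sup>2 * (sin (freq T j * t) / freq T j) - a\<^sup>2 * integral {0..t} (w j)))"
      using UV(2)[OF t] v(3) t by (simp add: E_def a(2))
    ultimately show "E t = G t - a\<^sup>2 * integral {0..t} D"
      by (simp add: iD right_diff_distrib sum_subtractf sum_distrib_left mult_ac)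
  qed (use T t in auto)
  then show ?thesis by (simp add: D_def)
qed

text \<open>Bilinearity: the left side is the squared norm of the superposition, with its second
  derivative expressed through the truncated source.\<close>

lemma mode_sum_square_sums:
  "lamk * (LINT t|lebesgue_on {0<..<T}. (mode_sum N t)\<^sup>2)
    + 1 / lamk * (LINT t|lebesgue_on {0<..<T}. (fourier_sum T f N t - lamk * mode_sum N t)\<^sup>2)
   = (\<Sum>j<N. \<Sum>l<N. fourier_coeff T f j * fourier_coeff T f l * mode_inner T c lamk (freq T j) (freq T l))"
proof -
  define w where "w j = wave_mode c a (freq T j)" for j
  define F where "F = fourier_coeff T f"
  define e where "e j t = cos (freq T j * t) - lamk * w j t" for j t
  have m: "mode_sum N t = (\<Sum>j<N. F j * w j t)" for t by (simp add: mode_sum_def F_def w_def)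
  have d: "fourier_sum T f N t - lamk * mode_sum N t = (\<Sum>j<N. F j * e j t)" for t
    by (simp add: m fourier_sum_def F_def[symmetric] e_def right_diff_distrib sum_subtractf sum_distrib_left mult_ac)
  have pt: "lamk * (mode_sum N t)\<^sup>2 + 1 / lamk * (fourier_sum T f N t - lamk * mode_sum N t)\<^sup>2
      = (\<Sum>j<N. \<Sum>l<N. F j * F l * mode_integrand c lamk a (freq T j) (freq T l) t)" for t
    unfolding d unfolding m power2_eq_square sum_product
    unfolding mode_integrand_def w_def[symmetric] e_def[symmetric]
    by (simp add: sum_distrib_left sum.distrib distrib_left mult_ac sum_divide_distrib)
  have "lamk * (LINT t|lebesgue_on {0<..<T}. (mode_sum N t)\<^sup>2)
    + 1 / lamk * (LINT t|lebesgue_on {0<..<T}. (fourier_sum T f N t - lamk * mode_sum N t)\<^sup>2)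
    = lamk * integral {0..T} (\<lambda>t. (mode_sum N t)\<^sup>2)
      + 1 / lamk * integral {0..T} (\<lambda>t. (fourier_sum T f N t - lamk * mode_sum N t)\<^sup>2)"
    by (intro arg_cong2[where f = "(+)"] arg_cong2[where f = "(*)"] refl LINT_lebesgue_on_continuous
        continuous_intros continuous_on_mode_sum continuous_on_fourier_sum)
  also have "\<dots> = integral {0..T} (\<lambda>t. lamk * (mode_sum N t)\<^sup>2)
      + integral {0..T} (\<lambda>t. 1 / lamk * (fourier_sum T f N t - lamk * mode_sum N t)\<^sup>2)"
    by simp
  also have "\<dots> = integral {0..T} (\<lambda>t. lamk * (mode_sum N t)\<^sup>2
      + 1 / lamk * (fourier_sum T f N t - lamk * mode_sum N t)\<^sup>2)"
    by (intro Henstock_Kurzweil_Integration.integral_add[symmetric] integrable_continuous_real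
        continuous_intros continuous_on_mode_sum continuous_on_fourier_sum)
  also have "\<dots> = integral {0..T} (\<lambda>t. \<Sum>j<N. \<Sum>l<N. F j * F l * mode_integrand c lamk a (freq T j) (freq T l) t)"
    unfolding pt ..
  also have "\<dots> = (\<Sum>j<N. \<Sum>l<N. F j * F l * integral {0..T} (mode_integrand c lamk a (freq T j) (freq T l)))"
  proof (rule integral_unique, intro has_integral_sum finite_lessThan has_integral_mult_right)
    show "(mode_integrand c lamk a (freq T j) (freq T l)
        has_integral integral {0..T} (mode_integrand c lamk a (freq T j) (freq T l))) {0..T}" for j l
      by (intro integrable_integral integrable_continuous_real continuous_on_mode_integrand)
  qed
  finally show ?thesis by (simp only: F_def mode_inner_def a_def)
qed

lemma partial_sums_tendsto_U_norm:
  "(\<lambda>N. \<Sum>j<N. \<Sum>l<N. fourier_coeff T f j * fourier_coeff T f l * mode_inner T c lamk (freq T j) (freq T l))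
    \<longlonglongrightarrow> (U_norm T c lamk u)\<^sup>2"
proof -
  obtain U V where UV: "continuous_on {0..T} U" "continuous_on {0..T} V"
    "AE t in lebesgue_on {0<..<T}. u t = U t"
    "AE t in lebesgue_on {0<..<T}. weak_deriv T (weak_deriv T u) t = c\<^sup>2 * (f t - lamk * u t)"
    "u \<in> L2_space {0<..<T}" "weak_deriv T (weak_deriv T u) \<in> L2_space {0<..<T}"
    "\<And>t. t \<in> {0..T} \<Longrightarrow> U t = integral {0..t} V"
    "\<And>t. t \<in> {0..T} \<Longrightarrow> V t = integral {0..t} (\<lambda>s. c\<^sup>2 * f s) - c\<^sup>2 * lamk * integral {0..t} U"
    using U_space_integral_equations[OF u f T c eq] by blast
  define \<delta> where "\<delta> N = (LINT t|lebesgue_on {0<..<T}. (f t - fourier_sum T f N t)\<^sup>2)" for N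
  have \<delta>: "\<delta> \<longlonglongrightarrow> 0" unfolding \<delta>_def by (rule fourier_sum_tendsto_L2[OF T f])
  have fsL: "fourier_sum T f N \<in> L2_space {0<..<T}" and mL: "mode_sum N \<in> L2_space {0<..<T}" for N
    by (intro continuous_in_L2_space continuous_on_fourier_sum continuous_on_mode_sum)+
  \<comment> \<open>The constant is (2 T c^2)^2 times T^2: one T is the length of the interval, the
    other comes from passing from L1 to L2.\<close>
  have uu: "(LINT t|lebesgue_on {0<..<T}. (mode_sum N t - u t)\<^sup>2) \<le> 4 * T^4 * c^4 * \<delta> N" for N
  proof -
    define L where "L = (LINT t|lebesgue_on {0<..<T}. \<bar>f t - fourier_sum T f N t\<bar>)"
    have "(LINT t|lebesgue_on {0<..<T}. (mode_sum N t - u t)\<^sup>2) \<le> T * (2 * T * (c\<^sup>2 * L))\<^sup>2"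
    proof (rule LINT_square_le_of_bound[OF T])
      show "AE t in lebesgue_on {0<..<T}. mode_sum N t - u t = mode_sum N t - U t"
        using UV(3) by eventually_elim simp
      show "(\<lambda>t. mode_sum N t - u t) \<in> L2_space {0<..<T}" by (intro L2_space_diff mL UV(5))
      show "\<bar>mode_sum N t - U t\<bar> \<le> 2 * T * (c\<^sup>2 * L)" if "t \<in> {0..T}" for t
        using mode_sum_error[OF UV(1,2,7,8) that, of N] unfolding L_def by (simp add: abs_minus_commute)
    qed
    also have "\<dots> = 4 * T^3 * c^4 * L\<^sup>2"
      by (simp add: power2_eq_square power3_eq_cube power4_eq_xxxx)
    also have "\<dots> \<le> 4 * T^3 * c^4 * (T * \<delta> N)"
      unfolding L_def \<delta>_def using T
      by (intro mult_left_mono L1_le_L2 L2_space_diff f fsL) auto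
    also have "\<dots> = 4 * T^4 * c^4 * \<delta> N" by (simp add: power3_eq_cube power4_eq_xxxx)
    finally show ?thesis .
  qed
  have lim_u: "(\<lambda>N. LINT t|lebesgue_on {0<..<T}. (mode_sum N t - u t)\<^sup>2) \<longlonglongrightarrow> 0"
  proof (rule tendsto_sandwich[OF _ _ tendsto_const])
    show "\<forall>\<^sub>F N in sequentially. (LINT t|lebesgue_on {0<..<T}. (mode_sum N t - u t)\<^sup>2) \<le> 4 * T^4 * c^4 * \<delta> N"
      using uu by simp
    show "(\<lambda>N. 4 * T^4 * c^4 * \<delta> N) \<longlonglongrightarrow> 0" by (rule tendsto_mult_right_zero[OF \<delta>])
  qed simp
  \<comment> \<open>Up to the factor c^2, \<open>r\<close> and \<open>R N\<close> are the second
    derivatives of the solution and of the superposition.\<close>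
  define r where "r t = f t - lamk * u t" for t
  define R where "R N t = fourier_sum T f N t - lamk * mode_sum N t" for N t
  have rL: "r \<in> L2_space {0<..<T}" and RL: "R N \<in> L2_space {0<..<T}" for N
    using L2_space_lincomb[OF f UV(5), of 1 "- lamk"] L2_space_lincomb[OF fsL mL, of 1 N "- lamk" N]
    by (simp_all add: r_def[abs_def] R_def[abs_def])
  have r_le: "(LINT t|lebesgue_on {0<..<T}. (R N t - r t)\<^sup>2)
      \<le> 3 * (\<delta> N + lamk\<^sup>2 * (LINT t|lebesgue_on {0<..<T}. (mode_sum N t - u t)\<^sup>2))" for N
  proof -
    have d1: "(\<lambda>t. f t - fourier_sum T f N t) \<in> L2_space {0<..<T}"
      by (intro L2_space_diff f fsL)
    have d2: "(\<lambda>t. lamk * (mode_sum N t - u t)) \<in> L2_space {0<..<T}"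
      using L2_space_lincomb[OF mL UV(5), of lamk N "- lamk"] by (simp add: right_diff_distrib)
    have d0: "(\<lambda>_. 0 :: real) \<in> L2_space {0<..<T}" by (rule continuous_in_L2_space) simp
    \<comment> \<open>The bracket is minus R - r, and a zero third summand lets
      \<open>LINT_square_sum3_le\<close> serve for two terms.\<close>
    have "(LINT t|lebesgue_on {0<..<T}. (R N t - r t)\<^sup>2)
        = (LINT t|lebesgue_on {0<..<T}. ((f t - fourier_sum T f N t) + lamk * (mode_sum N t - u t) + 0)\<^sup>2)"
      by (rule Bochner_Integration.integral_cong)
        (auto simp: R_def r_def power2_eq_square algebra_simps)
    also have "\<dots> \<le> 3 * (\<delta> N + (LINT t|lebesgue_on {0<..<T}. (lamk * (mode_sum N t - u t))\<^sup>2) +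
        (LINT t|lebesgue_on {0<..<T}. 0\<^sup>2))"
      unfolding \<delta>_def by (rule LINT_square_sum3_le[OF d1 d2 d0])
    finally show ?thesis by (simp add: power_mult_distrib)
  qed
  have lim_r: "(\<lambda>N. LINT t|lebesgue_on {0<..<T}. (R N t - r t)\<^sup>2) \<longlonglongrightarrow> 0"
  proof (rule tendsto_sandwich[OF _ _ tendsto_const])
    show "\<forall>\<^sub>F N in sequentially. (LINT t|lebesgue_on {0<..<T}. (R N t - r t)\<^sup>2)
        \<le> 3 * (\<delta> N + lamk\<^sup>2 * (LINT t|lebesgue_on {0<..<T}. (mode_sum N t - u t)\<^sup>2))"
      by (rule always_eventually) (intro allI r_le)
    have "(\<lambda>N. 3 * (\<delta> N + lamk\<^sup>2 * (LINT t|lebesgue_on {0<..<T}. (mode_sum N t - u t)\<^sup>2)))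
        \<longlonglongrightarrow> 3 * (0 + lamk\<^sup>2 * 0)"
      by (intro tendsto_mult tendsto_add tendsto_const \<delta> lim_u)
    then show "(\<lambda>N. 3 * (\<delta> N + lamk\<^sup>2 * (LINT t|lebesgue_on {0<..<T}. (mode_sum N t - u t)\<^sup>2)))
        \<longlonglongrightarrow> 0"
      by (simp only: mult_zero_right add_0_left)
  qed simp
  have "(\<lambda>N. lamk * (LINT t|lebesgue_on {0<..<T}. (mode_sum N t)\<^sup>2) + 1 / lamk * (LINT t|lebesgue_on {0<..<T}. (R N t)\<^sup>2))
      \<longlonglongrightarrow> lamk * (LINT t|lebesgue_on {0<..<T}. (u t)\<^sup>2) + 1 / lamk * (LINT t|lebesgue_on {0<..<T}. (r t)\<^sup>2)"
    by (intro tendsto_add tendsto_mult tendsto_const L2_converges_imp_square_converges mL UV(5) lim_u RL rL lim_r)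
  then show ?thesis
    unfolding U_norm_power2[OF c lamk UV(4,6,5) f] mode_sum_square_sums[symmetric] R_def r_def .
qed

end

section \<open>Unordered summability of the double series\<close>

text \<open>Because pi \<ge> 2, the j-th frequency is at least (j + 1) / T, so the series of inverse
  squares is a comparison.\<close>

lemma inverse_freq_square_sum_bounded:
  assumes "0 < T"
  obtains B where "\<And>N. (\<Sum>j<N. 1 / (freq T j)\<^sup>2) \<le> B"
proof
  fix N
  have sm: "summable (\<lambda>n. 1 / (real (n + 1))\<^sup>2)"
    using inverse_squares_sums by (simp add: sums_iff)
  have "1 / (freq T j)\<^sup>2 \<le> T\<^sup>2 * (1 / (real (j + 1))\<^sup>2)" for j
  proof -
    have "real j * 1 \<le> real j * pi" using pi_ge_two by (intro mult_left_mono) auto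
    then have "real (j + 1) \<le> pi / 2 + real j * pi" using pi_ge_two by simp
    then have "real (j + 1) / T \<le> freq T j"
      using assms by (simp add: freq_def divide_right_mono)
    then have "(real (j + 1) / T)\<^sup>2 \<le> (freq T j)\<^sup>2"
      using assms by (intro power_mono) auto
    then have "1 / (freq T j)\<^sup>2 \<le> 1 / (real (j + 1) / T)\<^sup>2"
      using assms freq_pos[OF assms, of j] by (intro divide_left_mono) auto
    then show ?thesis using assms by (simp add: power_divide)
  qed
  then have "(\<Sum>j<N. 1 / (freq T j)\<^sup>2) \<le> (\<Sum>j<N. T\<^sup>2 * (1 / (real (j + 1))\<^sup>2))"
    by (rule sum_mono)
  also have "\<dots> = T\<^sup>2 * (\<Sum>j<N. 1 / (real (j + 1))\<^sup>2)" by (simp only: sum_distrib_left)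
  also have "\<dots> \<le> T\<^sup>2 * (\<Sum>n. 1 / (real (n + 1))\<^sup>2)"
    by (intro mult_left_mono sum_le_suminf sm) auto
  finally show "(\<Sum>j<N. 1 / (freq T j)\<^sup>2) \<le> T\<^sup>2 * (\<Sum>n. 1 / (real (n + 1))\<^sup>2)" .
qed

text \<open>Bounded absolute square sums give unordered summability. Every finite set of pairs lies
  in all sufficiently large squares, so the limit along squares identifies the sum.\<close>

lemma has_sum_square_limit:
  fixes g :: "nat \<times> nat \<Rightarrow> real"
  assumes bound: "\<And>N. (\<Sum>j<N. \<Sum>l<N. \<bar>g (j, l)\<bar>) \<le> B"
    and lim: "(\<lambda>N. \<Sum>j<N. \<Sum>l<N. g (j, l)) \<longlonglongrightarrow> L"
  shows "(g has_sum L) (UNIV \<times> UNIV)"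
proof -
  have cover: "\<exists>N. \<forall>n\<ge>N. F \<subseteq> {..<n} \<times> {..<n}" if "finite F" for F :: "(nat \<times> nat) set"
  proof -
    have "finite (fst ` F \<union> snd ` F)" using that by simp
    then obtain N where "fst ` F \<union> snd ` F \<subseteq> {..<N}"
      using finite_nat_iff_bounded by blast
    then have "F \<subseteq> {..<n} \<times> {..<n}" if "n \<ge> N" for n
      using that by fastforce
    then show ?thesis by blast
  qed
  have "(\<lambda>x. norm (g x)) summable_on UNIV"
  proof (rule nonneg_bdd_above_summable_on)
    show "bdd_above (sum (\<lambda>x. norm (g x)) ` {F. F \<subseteq> UNIV \<and> finite F})"
    proof (rule bdd_aboveI2)
      fix F :: "(nat \<times> nat) set" assume "F \<in> {F. F \<subseteq> UNIV \<and> finite F}"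
      then obtain N where "F \<subseteq> {..<N} \<times> {..<N}" using cover[of F] by blast
      then have "(\<Sum>x\<in>F. norm (g x)) \<le> (\<Sum>x\<in>{..<N} \<times> {..<N}. norm (g x))"
        by (intro sum_mono2) auto
      also have "\<dots> = (\<Sum>j<N. \<Sum>l<N. \<bar>g (j, l)\<bar>)"
        by (simp add: sum.cartesian_product)
      also have "\<dots> \<le> B" by (rule bound)
      finally show "(\<Sum>x\<in>F. norm (g x)) \<le> B" .
    qed
  qed simp
  then have "g summable_on UNIV" by (rule abs_summable_summable)
  then have hs: "(g has_sum infsum g UNIV) UNIV" by (rule has_sum_infsum)
  have "filterlim (\<lambda>N. {..<N} \<times> {..<N}) (finite_subsets_at_top UNIV) sequentially"
    unfolding filterlim_finite_subsets_at_top eventually_sequentially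
    using cover by auto
  with hs have "(\<lambda>N. sum g ({..<N} \<times> {..<N})) \<longlonglongrightarrow> infsum g UNIV"
    unfolding has_sum_def by (rule filterlim_compose)
  then have "(\<lambda>N. \<Sum>j<N. \<Sum>l<N. g (j, l)) \<longlonglongrightarrow> infsum g UNIV"
    by (simp add: sum.cartesian_product)
  then have "infsum g UNIV = L" using lim by (rule LIMSEQ_unique)
  with hs show ?thesis by simp
qed

text \<open>Beyond the diagonal part, which Bessel controls, each term is at most K p_j p_l with p_j
  = |F_j| / \<omega>_j. The double sum of these factors into the square of the sum of the p_j, which
  is finite by Bessel and the inverse squares.\<close>

lemma mode_inner_series_bounded:
  assumes T: "0 < T" and c: "0 < c" and lamk: "0 < lamk" and f: "f \<in> L2_space {0<..<T}"
  obtains B where "\<And>N. (\<Sum>j<N. \<Sum>l<N. \<bar>fourier_coeff T f j * fourier_coeff T f l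
      * mode_inner T c lamk (freq T j) (freq T l)\<bar>) \<le> B"
proof -
  obtain B where B: "\<And>N. (\<Sum>j<N. 1 / (freq T j)\<^sup>2) \<le> B"
    using inverse_freq_square_sum_bounded[OF T] by blast
  define F where "F = fourier_coeff T f"
  define Q where "Q = 2 / T * (LINT t|lebesgue_on {0<..<T}. (f t)\<^sup>2)"
  have Q: "(\<Sum>j<N. (F j)\<^sup>2) \<le> Q" for N
    using Bessel_inequality[OF T f, of N] T by (simp add: Q_def F_def field_simps)
  define K where "K = 2 * (3 * T * c\<^sup>2 + 2 * T^3 * (sqrt (mu c lamk))\<^sup>2 * c\<^sup>2) + 8 * lamk * T^3 * c^4"
  have K: "0 \<le> K" using T lamk by (simp add: K_def)
  define p where "p j = \<bar>F j\<bar> / freq T j" for j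
  have p0: "0 \<le> p j" for j using freq_pos[OF T, of j] by (simp add: p_def)
  \<comment> \<open>The arithmetic-geometric mean inequality bounds even 2 p_j; one copy is dropped
    since p_j \<ge> 0.\<close>
  have "p j \<le> (F j)\<^sup>2 + 1 / (freq T j)\<^sup>2" for j
    using sum_squares_bound[of "\<bar>F j\<bar>" "1 / freq T j"] p0[of j] by (simp add: p_def power_divide)
  then have "(\<Sum>j<N. p j) \<le> (\<Sum>j<N. (F j)\<^sup>2 + 1 / (freq T j)\<^sup>2)" for N by (rule sum_mono)
  also have "(\<Sum>j<N. (F j)\<^sup>2 + 1 / (freq T j)\<^sup>2) \<le> Q + B" for N
    using Q[of N] B[of N] by (simp add: sum.distrib)
  finally have P: "(\<Sum>j<N. p j) \<le> Q + B" for N .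
  have term_bound: "\<bar>F j * F l * mode_inner T c lamk (freq T j) (freq T l)\<bar>
      \<le> (if j = l then T / (2 * lamk) * (F j)\<^sup>2 else 0) + K * (p j * p l)" for j l
  proof -
    have "\<bar>mode_inner T c lamk (freq T j) (freq T l)\<bar>
        \<le> \<bar>if j = l then T / 2 else 0\<bar> / lamk + K / (freq T j * freq T l)"
      using mode_inner_bound[OF T c lamk freq_pos[OF T, of j] freq_pos[OF T, of l]]
      unfolding integral_cos_freq_cos_freq[OF T] K_def .
    then have "\<bar>F j * F l\<bar> * \<bar>mode_inner T c lamk (freq T j) (freq T l)\<bar>
        \<le> \<bar>F j * F l\<bar> * (\<bar>if j = l then T / 2 else 0\<bar> / lamk + K / (freq T j * freq T l))"
      by (rule mult_left_mono) simp
    also have "\<dots> = (if j = l then T / (2 * lamk) * (F j)\<^sup>2 else 0) + K * (p j * p l)"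
      using T by (auto simp: p_def abs_mult distrib_left power2_eq_square mult_ac)
    finally show ?thesis by (simp add: abs_mult)
  qed
  show ?thesis
  proof (rule that)
    fix N
    have "(\<Sum>j<N. \<Sum>l<N. \<bar>F j * F l * mode_inner T c lamk (freq T j) (freq T l)\<bar>)
        \<le> (\<Sum>j<N. \<Sum>l<N. (if j = l then T / (2 * lamk) * (F j)\<^sup>2 else 0) + K * (p j * p l))"
      by (intro sum_mono term_bound)
    also have "\<dots> = T / (2 * lamk) * (\<Sum>j<N. (F j)\<^sup>2) + K * ((\<Sum>j<N. p j) * (\<Sum>l<N. p l))"
      unfolding sum_product by (simp add: sum.distrib sum.delta sum_distrib_left)
    also have "\<dots> \<le> T / (2 * lamk) * Q + K * ((Q + B) * (Q + B))"
      using P[of N] Q[of N] T lamk K p0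
      by (intro add_mono mult_left_mono mult_mono') (auto intro: sum_nonneg)
    finally show "(\<Sum>j<N. \<Sum>l<N. \<bar>fourier_coeff T f j * fourier_coeff T f l
        * mode_inner T c lamk (freq T j) (freq T l)\<bar>) \<le> T / (2 * lamk) * Q + K * ((Q + B) * (Q + B))"
      unfolding F_def .
  qed
qed

theorem proposition4p2:
  fixes \<Omega> :: "(real ^ 'd) set"
    and T c :: real
    and lam :: "nat \<Rightarrow> real"
    and k :: nat
    and f u :: "real \<Rightarrow> real"
  assumes "0 < T" and "0 < c"
    and "open \<Omega>" and "bounded \<Omega>" and "connected \<Omega>" and "lipschitz_boundary \<Omega>"
    and "dirichlet_eigenvalues \<Omega> lam"
    and "1 \<le> k"
    and "f \<in> L2_space {0<..<T}"
    and "u \<in> U_space T"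
    and "AE t in lebesgue_on {0<..<T}.
           1 / c\<^sup>2 * weak_deriv T (weak_deriv T u) t + lam k * u t = f t"
  shows "continuous_on ({0<..} \<times> {0<..}) (\<lambda>(\<omega>, \<omega>'). W T c (lam k) \<omega> \<omega>') \<and>
    ((\<lambda>(j, l). W T c (lam k) (freq T j) (freq T l) * fourier_coeff T f j * fourier_coeff T f l)
       has_sum (U_norm T c (lam k) u)\<^sup>2) (UNIV \<times> UNIV) \<and>
    (\<forall>j. W T c (lam k) (freq T j) (freq T j) =
       (1 + C_const T c (lam k) (freq T j)) * (Vstar_norm T (lam k) (\<lambda>t. cos (freq T j * t)))\<^sup>2)"
proof -
  have lamk: "0 < lam k"
    using assms(7,8) by (auto simp: dirichlet_eigenvalues_def)
  note pos = assms(1,2) lamk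
  have W: "W T c (lam k) (freq T j) (freq T l) * fourier_coeff T f j * fourier_coeff T f l
      = fourier_coeff T f j * fourier_coeff T f l * mode_inner T c (lam k) (freq T j) (freq T l)" for j l
    using W_eq_mode_inner[OF pos] freq_pos[OF assms(1)] by simp
  obtain B where B: "\<And>N. (\<Sum>j<N. \<Sum>l<N. \<bar>fourier_coeff T f j * fourier_coeff T f l
      * mode_inner T c (lam k) (freq T j) (freq T l)\<bar>) \<le> B"
    using mode_inner_series_bounded[OF pos assms(9)] by blast
  have "((\<lambda>(j, l). W T c (lam k) (freq T j) (freq T l) * fourier_coeff T f j * fourier_coeff T f l)
       has_sum (U_norm T c (lam k) u)\<^sup>2) (UNIV \<times> UNIV)"
    \<comment> \<open>\<open>B\<close> provides the unordered convergence, and the limit of the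
      square sums provides the value.\<close>
    by (rule has_sum_square_limit[of _ B])
      (simp_all only: prod.case W B partial_sums_tendsto_U_norm[OF pos assms(9-11)])
  with continuous_on_W[OF pos] W_diagonal[OF pos] show ?thesis by blast
qed

end
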